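(* Let $\Sigma$ be an integer alphabet of size $\sigma>1$, and let $x$ be a string of length $n$ over $\Sigma$ whose letters are independent and identically distributed random variables, each uniformly distributed over $\Sigma$. Let $m$ be an integer with $1\le m<n$ and $m \geq 3 \cdot \frac{\log n}{\log \sigma}+3$. Then the \textsc{1-mappability} problem for $x$ and $m$ can be solved by a deterministic algorithm in average-case (expected) time $\mathcal{O}(n)$ and space $\mathcal{O}(n)$.
   Context: For strings $y,z$ of equal length, the Hamming distance $d_H(y,z)$ is the number of positions at which they differ. For a string $x=x[0]x[1]\cdots x[n-1]$, $x[i\,..\,j]=x[i]\cdots x[j]$ denotes a factor. An integer alphabet means the letters are integers in $\{1,\ldots,n\}$ (after ranking). The \textsc{1-mappability} problem: given a string $x$ of length $n$ and an integer $m$ with $1\le m<n$, output an integer array $C$ of size $n-m+1$ such that, for each $0\le i\le n-m$, $C[i]$ is the number of length-$m$ factors of $x$ (counted by starting position $j\in\{0,\ldots,n-m\}$) that are at Hamming distance exactly $1$ from $x[i\,..\,i+m-1]$. The model of computation is the standard word RAM. *)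

theory Defs
  imports "HOL-Probability.Probability"
begin

section \<open>The 1-mappability problem\<close>

text \<open>Strings are lists, indexed from 0 as in \<open>x[0] \<dots> x[n-1]\<close>. The Hamming distance is only
  meaningful for lists of equal length.\<close>

definition hamming_dist :: "'a list \<Rightarrow> 'a list \<Rightarrow> nat" where
  "hamming_dist y z = card {p. p < length y \<and> y ! p \<noteq> z ! p}"

definition factor :: "'a list \<Rightarrow> nat \<Rightarrow> nat \<Rightarrow> 'a list" where
  "factor x i j = map (nth x) [i..<Suc j]"

definition mappability1 :: "'a list \<Rightarrow> nat \<Rightarrow> nat list" where
  "mappability1 x m =
     map (\<lambda>i. card {j \<in> {0..length x - m}.
                    hamming_dist (factor x i (i + m - 1)) (factor x j (j + m - 1)) = 1})
         [0..<length x - m + 1]"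


section \<open>The word RAM\<close>

text \<open>
  A machine of word size \<open>w\<close> works on \<open>w\<close>-bit words, represented by the natural numbers below
  \<open>2^w\<close>. It has registers, of which a program (a finite list of instructions) can only mention
  finitely many, and a random-access memory addressed by words. Every instruction takes unit time.
  One and the same program has to run at all word sizes, hence program literals are reduced
  modulo \<open>2^w\<close>.
\<close>

datatype binop = Add | Sub | Mul | Div | Mod | And | Or | Xor | Shl | Shr | Less | Equal

fun binop_val :: "nat \<Rightarrow> binop \<Rightarrow> nat \<Rightarrow> nat \<Rightarrow> nat" where
  "binop_val w Add a b = (a + b) mod 2 ^ w"
| "binop_val w Sub a b = (a + (2 ^ w - b)) mod 2 ^ w"
| "binop_val w Mul a b = (a * b) mod 2 ^ w"
| "binop_val w Div a b = a div b"
| "binop_val w Mod a b = a mod b"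
| "binop_val w And a b = Bit_Operations.and a b"
| "binop_val w Or a b = Bit_Operations.or a b"
| "binop_val w Xor a b = Bit_Operations.xor a b"
| "binop_val w Shl a b = push_bit b a mod 2 ^ w"
| "binop_val w Shr a b = drop_bit b a"
| "binop_val w Less a b = of_bool (a < b) mod 2 ^ w"
| "binop_val w Equal a b = of_bool (a = b) mod 2 ^ w"

type_synonym reg = nat

datatype instr =
    Const reg nat
  | Op binop reg reg reg
  | Load reg reg
  | Store reg reg
  | Jump nat
  | JumpZero reg nat

type_synonym program = "instr list"

record state =
  pc :: nat
  regs :: "reg \<Rightarrow> nat"
  mem :: "nat \<Rightarrow> nat"

text \<open>\<open>Load r a\<close> reads the cell whose address is in register \<open>a\<close>; \<open>Store a r\<close> writes
  register \<open>r\<close> to the cell whose address is in register \<open>a\<close>.\<close>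

fun exec :: "nat \<Rightarrow> instr \<Rightarrow> state \<Rightarrow> state" where
  "exec w (Const r k) s = s\<lparr>pc := pc s + 1, regs := (regs s)(r := k mod 2 ^ w)\<rparr>"
| "exec w (Op f r a b) s =
     s\<lparr>pc := pc s + 1, regs := (regs s)(r := binop_val w f (regs s a) (regs s b))\<rparr>"
| "exec w (Load r a) s = s\<lparr>pc := pc s + 1, regs := (regs s)(r := mem s (regs s a))\<rparr>"
| "exec w (Store a r) s = s\<lparr>pc := pc s + 1, mem := (mem s)(regs s a := regs s r)\<rparr>"
| "exec w (Jump l) s = s\<lparr>pc := l\<rparr>"
| "exec w (JumpZero r l) s = s\<lparr>pc := (if regs s r = 0 then l else pc s + 1)\<rparr>"

definition halted :: "program \<Rightarrow> state \<Rightarrow> bool" where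
  "halted P s \<longleftrightarrow> length P \<le> pc s"

definition step :: "nat \<Rightarrow> program \<Rightarrow> state \<Rightarrow> state" where
  "step w P s = (if halted P s then s else exec w (P ! pc s) s)"

definition run :: "nat \<Rightarrow> program \<Rightarrow> nat \<Rightarrow> state \<Rightarrow> state" where
  "run w P t s = (step w P ^^ t) s"

definition halts :: "nat \<Rightarrow> program \<Rightarrow> state \<Rightarrow> bool" where
  "halts w P s \<longleftrightarrow> (\<exists>t. halted P (run w P t s))"

text \<open>Running time, final state and space are meaningful for halting computations only.\<close>

definition run_time :: "nat \<Rightarrow> program \<Rightarrow> state \<Rightarrow> nat" where
  "run_time w P s = (LEAST t. halted P (run w P t s))"

definition final_state :: "nat \<Rightarrow> program \<Rightarrow> state \<Rightarrow> state" where
  "final_state w P s = run w P (run_time w P s) s"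

fun accessed :: "instr \<Rightarrow> state \<Rightarrow> nat set" where
  "accessed (Load r a) s = {regs s a}"
| "accessed (Store a r) s = {regs s a}"
| "accessed _ s = {}"

text \<open>Space is the length of the initial segment of memory that contains all cells ever read or
  written. Counting only the distinct cells accessed would make sparsely used,
  zero-initialised tables of size \<open>2^w\<close> cheap.\<close>

definition run_space :: "nat \<Rightarrow> program \<Rightarrow> state \<Rightarrow> nat" where
  "run_space w P s =
     (LEAST b. \<forall>t < run_time w P s. \<forall>a \<in> accessed (P ! pc (run w P t s)) (run w P t s). a < b)"

text \<open>Input: \<open>n\<close> and \<open>m\<close> in registers 0 and 1, the string in memory cells \<open>0..n-1\<close>. In
  particular neither the alphabet nor the word size is given.
  Output: the array \<open>C\<close> in memory cells \<open>0..n-m\<close>, which may overwrite the input.\<close>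

definition input_state :: "nat list \<Rightarrow> nat \<Rightarrow> state" where
  "input_state x m =
     \<lparr>pc = 0,
      regs = (\<lambda>_. 0)(0 := length x, 1 := m),
      mem = (\<lambda>a. if a < length x then x ! a else 0)\<rparr>"

definition solves_mappability1 :: "nat \<Rightarrow> program \<Rightarrow> nat list \<Rightarrow> nat \<Rightarrow> bool" where
  "solves_mappability1 w P x m \<longleftrightarrow>
     halts w P (input_state x m) \<and>
     (\<forall>i \<in> {0..length x - m}.
        mem (final_state w P (input_state x m)) i = mappability1 x m ! i)"

end

theory Submission
  imports Defs
begin

text \<open>
  Cut the window of length \<open>m\<close> into halves of lengths \<open>h = m div 2\<close> and \<open>m - h\<close>. Two factors at
  Hamming distance 1 agree on exactly one of the halves. So it suffices to enumerate the pairs of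
  positions at which the next \<open>l\<close> letters agree, where \<open>l\<close> is the least number with \<open>s ^ l \<ge> n\<close> for
  the number \<open>s\<close> of letters that occur (but at most \<open>h\<close>), to extend the agreement letter by
  letter to a half, and only if this succeeds to count the mismatches in the other half.

  The \<open>l\<close>-letter windows are coded by numbers below \<open>n\<^sup>2\<close>, in base \<open>s\<close> with the ranks of the letters
  as digits. Positions of equal code are linked in time and space \<open>O(n)\<close> by a two-digit bucket sort.

  In a random string two given windows of length \<open>L\<close> agree with probability at most \<open>\<sigma>\<close> to the
  power \<open>-L\<close>. As \<open>s \<le> \<sigma>\<close>, the expected number of pairs and of extension steps is \<open>O(n)\<close>. The
  assumption on \<open>m\<close> gives \<open>n * m \<le> 3 * \<sigma> ^ h\<close>, so counting mismatches costs \<open>O(n)\<close> on average as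
  well.
\<close>

section \<open>A structured language on top of the word RAM\<close>

text \<open>Correctness and the space bound hold for every string; only the running time is
  averaged. The link is \<open>total_work\<close>, which bounds the work and mentions only which
  windows of the string agree, so that its mean is a matter of counting strings. The machine does
  not know \<open>\<Sigma>\<close>, so the codes use the number \<open>s\<close> of occurring
  letters as base, and the window length \<open>l\<close> varies with the string. The analysis
  replaces it by the least \<open>l0\<close> with \<open>n \<le> \<sigma> ^ l0\<close>: it never
  exceeds \<open>l\<close>, and shorter windows can only increase \<open>total_work\<close>.
  Stopping at the first power that reaches \<open>n\<close> serves two ends:
  \<open>s ^ (l - 1) < n\<close> keeps the codes small enough for the sort, and
  \<open>n \<le> s ^ l\<close> keeps the expected number of linked pairs linear. Counting mismatches
  costs up to \<open>m\<close> per pair, too much for all linked pairs, hence the extension to a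
  full half before it. Words wrap around, so every operation of the structured language comes with
  the obligation that it does not overflow.\<close>

datatype expr = Lit nat | Var nat | Bin binop expr expr | Arr nat expr

text \<open>The catch-all 0 is a dummy: \<open>no_overflow\<close> is False for the bitwise
  operations, so a \<open>safe\<close> expression never evaluates one.\<close>

fun arith :: "binop \<Rightarrow> nat \<Rightarrow> nat \<Rightarrow> nat" where
  "arith Add a b = a + b"
| "arith Sub a b = a - b"
| "arith Mul a b = a * b"
| "arith Div a b = a div b"
| "arith Mod a b = a mod b"
| "arith Less a b = of_bool (a < b)"
| "arith Equal a b = of_bool (a = b)"
| "arith _ a b = 0"

text \<open>Subtraction must not borrow, since the machine wraps around where natural numbers
  truncate. Truth values need \<open>1 < W\<close> because the machine reduces them as well.\<close>

fun no_overflow :: "nat \<Rightarrow> binop \<Rightarrow> nat \<Rightarrow> nat \<Rightarrow> bool" where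
  "no_overflow W Add a b \<longleftrightarrow> a + b < W"
| "no_overflow W Sub a b \<longleftrightarrow> b \<le> a \<and> a < W"
| "no_overflow W Mul a b \<longleftrightarrow> a * b < W"
| "no_overflow W Div a b \<longleftrightarrow> True"
| "no_overflow W Mod a b \<longleftrightarrow> True"
| "no_overflow W Less a b \<longleftrightarrow> 1 < W"
| "no_overflow W Equal a b \<longleftrightarrow> 1 < W"
| "no_overflow W _ a b \<longleftrightarrow> False"

type_synonym vars = "nat \<Rightarrow> nat"
type_synonym arrays = "nat \<Rightarrow> nat \<Rightarrow> nat"

fun ev :: "expr \<Rightarrow> vars \<Rightarrow> arrays \<Rightarrow> nat" where
  "ev (Lit k) v A = k"
| "ev (Var r) v A = v r"
| "ev (Bin f a b) v A = arith f (ev a v A) (ev b v A)"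
| "ev (Arr k e) v A = A k (ev e v A)"

text \<open>Registers below 31 hold variables, register 31 the common length \<open>S\<close> of the eight arrays,
  and registers from 32 on intermediate results. Array \<open>k\<close> occupies the cells from \<open>k * S\<close> on.\<close>

fun safe :: "nat \<Rightarrow> nat \<Rightarrow> expr \<Rightarrow> vars \<Rightarrow> arrays \<Rightarrow> bool" where
  "safe W S (Lit k) v A \<longleftrightarrow> k < W"
| "safe W S (Var r) v A \<longleftrightarrow> r < 31"
| "safe W S (Bin f a b) v A \<longleftrightarrow>
     safe W S a v A \<and> safe W S b v A \<and> no_overflow W f (ev a v A) (ev b v A)"
| "safe W S (Arr k e) v A \<longleftrightarrow> safe W S e v A \<and> k < 8 \<and> ev e v A < S"

text \<open>Expressions compile to straight-line code, so this is code length and running time at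
  once. The 4 pays for the address computation and the load.\<close>

fun ecost :: "expr \<Rightarrow> nat" where
  "ecost (Lit k) = 1"
| "ecost (Var r) = 1"
| "ecost (Bin f a b) = ecost a + ecost b + 1"
| "ecost (Arr k e) = ecost e + 4"

datatype com =
    Skip
  | Assign nat expr  ("_ ::= _" [1000, 61] 61)
  | Put nat expr expr
  | Seq com com  (infixr ";;" 60)
  | If expr com com
  | While expr com

text \<open>The time is the exact instruction count of the compiled code. A true test is charged 2,
  for the conditional jump and for the jump that leaves the branch or returns to the loop head; a
  false one is charged 1.\<close>

inductive big :: "nat \<Rightarrow> nat \<Rightarrow> com \<Rightarrow> vars \<Rightarrow> arrays \<Rightarrow> nat \<Rightarrow> vars \<Rightarrow> arrays \<Rightarrow> bool"
  for W S where
  Skip: "big W S Skip v A 0 v A"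
| Assign: "safe W S e v A \<Longrightarrow> r < 31 \<Longrightarrow> big W S (r ::= e) v A (ecost e + 1) (v(r := ev e v A)) A"
| Put: "safe W S i v A \<Longrightarrow> safe W S e v A \<Longrightarrow> k < 8 \<Longrightarrow> ev i v A < S \<Longrightarrow>
    big W S (Put k i e) v A (ecost e + ecost i + 4) v (A(k := (A k)(ev i v A := ev e v A)))"
| Seq: "big W S c v A t v' A' \<Longrightarrow> big W S d v' A' t' v'' A'' \<Longrightarrow> big W S (c ;; d) v A (t + t') v'' A''"
| IfT: "safe W S e v A \<Longrightarrow> ev e v A \<noteq> 0 \<Longrightarrow> big W S c v A t v' A' \<Longrightarrow>
    big W S (If e c d) v A (ecost e + 2 + t) v' A'"
| IfF: "safe W S e v A \<Longrightarrow> ev e v A = 0 \<Longrightarrow> big W S d v A t v' A' \<Longrightarrow>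
    big W S (If e c d) v A (ecost e + 1 + t) v' A'"
| WhileF: "safe W S e v A \<Longrightarrow> ev e v A = 0 \<Longrightarrow> big W S (While e c) v A (ecost e + 1) v A"
| WhileT: "safe W S e v A \<Longrightarrow> ev e v A \<noteq> 0 \<Longrightarrow> big W S c v A t v' A' \<Longrightarrow>
    big W S (While e c) v' A' t' v'' A'' \<Longrightarrow>
    big W S (While e c) v A (ecost e + 2 + t + t') v'' A''"

inductive_cases SkipE: "big W S Skip v A t v' A'"
inductive_cases AssignE: "big W S (r ::= e) v A t v' A'"
inductive_cases PutE: "big W S (Put k i e) v A t v' A'"
inductive_cases SeqE: "big W S (c ;; d) v A t v' A'"
inductive_cases IfE: "big W S (If e c d) v A t v' A'"

text \<open>Registers from \<open>d\<close> upwards serve as a stack. There is no move instruction;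
  \<open>Or\<close> of a register with itself copies it.\<close>

fun compile_expr :: "expr \<Rightarrow> reg \<Rightarrow> program" where
  "compile_expr (Lit k) d = [Const d k]"
| "compile_expr (Var r) d = [Op Or d r r]"
| "compile_expr (Bin f a b) d = compile_expr a d @ compile_expr b (Suc d) @ [Op f d d (Suc d)]"
| "compile_expr (Arr k e) d =
     compile_expr e d @ [Const (Suc d) k, Op Mul (Suc d) (Suc d) 31, Op Add d d (Suc d), Load d d]"

text \<open>Jump targets are absolute, so \<open>compile\<close> needs code lengths before the code
  exists.\<close>

fun clen :: "com \<Rightarrow> nat" where
  "clen Skip = 0"
| "clen (r ::= e) = ecost e + 1"
| "clen (Put k i e) = ecost e + ecost i + 4"
| "clen (c ;; d) = clen c + clen d"
| "clen (If e c d) = ecost e + clen c + clen d + 2"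
| "clen (While e c) = ecost e + clen c + 2"

fun compile :: "com \<Rightarrow> nat \<Rightarrow> program" where
  "compile Skip p = []"
| "compile (r ::= e) p = compile_expr e 32 @ [Op Or r 32 32]"
| "compile (Put k i e) p = compile_expr e 32 @ compile_expr i 33 @
     [Const 34 k, Op Mul 34 34 31, Op Add 33 33 34, Store 33 32]"
| "compile (c ;; d) p = compile c p @ compile d (p + clen c)"
| "compile (If e c d) p =
     compile_expr e 32 @ [JumpZero 32 (p + ecost e + clen c + 2)] @ compile c (p + ecost e + 1) @
     [Jump (p + ecost e + clen c + clen d + 2)] @ compile d (p + ecost e + clen c + 2)"
| "compile (While e c) p =
     compile_expr e 32 @ [JumpZero 32 (p + ecost e + clen c + 2)] @ compile c (p + ecost e + 1) @ [Jump p]"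

lemma length_compile_expr [simp]: "length (compile_expr e d) = ecost e"
  by (induction e arbitrary: d) auto

lemma length_compile [simp]: "length (compile c p) = clen c"
  by (induction c arbitrary: p) auto

section \<open>Correctness of the compiler\<close>

definition code_at :: "program \<Rightarrow> nat \<Rightarrow> program \<Rightarrow> bool" where
  "code_at P i C \<longleftrightarrow> i + length C \<le> length P \<and> (\<forall>k < length C. P ! (i + k) = C ! k)"

lemma code_at_Cons: "code_at P i (a # C) \<longleftrightarrow> i < length P \<and> P ! i = a \<and> code_at P (Suc i) C"
  unfolding code_at_def by (auto simp: less_Suc_eq_0_disj)

lemma code_at_append:
  "code_at P i (C @ D) \<longleftrightarrow> code_at P i C \<and> code_at P (i + length C) D"
proof (induction C arbitrary: i)
  case Nil
  then show ?case by (auto simp: code_at_def)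
next
  case (Cons a C)
  then show ?case by (auto simp: code_at_Cons)
qed

text \<open>The address bound \<open>b\<close> travels with the run because space is a property of
  all intermediate states, not of the final one.\<close>

inductive reach :: "nat \<Rightarrow> nat \<Rightarrow> program \<Rightarrow> nat \<Rightarrow> state \<Rightarrow> state \<Rightarrow> bool" for w b P where
  here: "reach w b P 0 s s"
| further: "pc s < length P \<Longrightarrow> (\<forall>a \<in> accessed (P ! pc s) s. a < b) \<Longrightarrow>
    reach w b P t (exec w (P ! pc s) s) s' \<Longrightarrow> reach w b P (Suc t) s s'"

lemma reach_trans:
  "reach w b P t s s' \<Longrightarrow> reach w b P t' s' s'' \<Longrightarrow> reach w b P (t + t') s s''"
  by (induction rule: reach.induct) (auto intro: reach.intros)

lemma reach_one:
  "pc s < length P \<Longrightarrow> (\<forall>a \<in> accessed (P ! pc s) s. a < b) \<Longrightarrow> s' = exec w (P ! pc s) s \<Longrightarrow>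
    reach w b P (Suc 0) s s'"
  by (auto intro: reach.intros)

lemma reach_run:
  assumes "reach w b P t s s'"
  shows "run w P t s = s' \<and>
    (\<forall>u < t. \<forall>a \<in> accessed (P ! pc (run w P u s)) (run w P u s). a < b)"
  using assms
proof (induction rule: reach.induct)
  case (here s)
  then show ?case by (simp add: run_def)
next
  case (further s t s')
  have *: "run w P (Suc u) s = run w P u (exec w (P ! pc s) s)" for u
    using further.hyps by (simp add: run_def funpow_Suc_right step_def halted_def del: funpow.simps)
  have "run w P 0 s = s" by (simp add: run_def)
  then have "a < b" if "u < Suc t" "a \<in> accessed (P ! pc (run w P u s)) (run w P u s)" for u a
    using that further by (cases u) (auto simp: *)
  with * further.IH show ?case by simp
qed

definition represents :: "nat \<Rightarrow> vars \<Rightarrow> arrays \<Rightarrow> state \<Rightarrow> bool" where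
  "represents S v A s \<longleftrightarrow> (\<forall>r < 31. regs s r = v r) \<and> regs s 31 = S \<and>
     (\<forall>k < 8. \<forall>i < S. mem s (k * S + i) = A k i)"

lemma binop_val_arith:
  assumes "no_overflow (2 ^ w) f a b"
  shows "binop_val w f a b = arith f a b"
proof (cases "f = Sub")
  case True
  with assms have "a + (2 ^ w - b) = (a - b) + 2 ^ w" by simp
  then have "(a + (2 ^ w - b)) mod 2 ^ w = (a - b) mod 2 ^ w" by (metis mod_add_self2)
  with True assms show ?thesis by (simp add: less_imp_diff_less)
next
  case False
  with assms show ?thesis by (cases f) (auto simp: of_bool_def)
qed

lemma address_bound: "k < 8 \<Longrightarrow> i < S \<Longrightarrow> k * S + i < 8 * (S::nat)"
proof -
  assume "k < 8" "i < S"
  then have "k * S \<le> 7 * S" by (intro mult_right_mono) auto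
  with \<open>i < S\<close> show ?thesis by linarith
qed

text \<open>Registers below \<open>d\<close> must be preserved: the left operand waits in
  \<open>d\<close> while the right one is computed from \<open>Suc d\<close> on, and the variables
  live below 32.\<close>

lemma compile_expr_correct:
  assumes "code_at P (pc s) (compile_expr e d)" "32 \<le> d" "represents S v A s"
    "safe (2 ^ w) S e v A" "8 * S \<le> 2 ^ w"
  shows "\<exists>s'. reach w (8 * S) P (ecost e) s s' \<and> pc s' = pc s + ecost e \<and> mem s' = mem s \<and>
    regs s' d = ev e v A \<and> (\<forall>r < d. regs s' r = regs s r)"
  using assms
proof (induction e arbitrary: s d)
  case (Lit k)
  then show ?case
    by (intro exI[of _ "exec w (Const d k) s"])
      (auto simp: code_at_Cons intro!: reach_one)
next
  case (Var r)
  then show ?case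
    by (intro exI[of _ "exec w (Op Or d r r) s"])
      (auto simp: code_at_Cons represents_def intro!: reach_one)
next
  case (Bin f a b)
  then have c: "code_at P (pc s) (compile_expr a d)" "code_at P (pc s + ecost a) (compile_expr b (Suc d))"
    and o: "pc s + ecost a + ecost b < length P" "P ! (pc s + ecost a + ecost b) = Op f d d (Suc d)"
    by (auto simp: code_at_append code_at_Cons)
  from Bin.IH(1)[OF c(1)] Bin.prems obtain s1 where
    1: "reach w (8 * S) P (ecost a) s s1" "pc s1 = pc s + ecost a" "mem s1 = mem s"
    "regs s1 d = ev a v A" "\<forall>r < d. regs s1 r = regs s r" by auto
  then have "represents S v A s1" using Bin.prems by (auto simp: represents_def)
  with Bin.IH(2)[of s1 "Suc d"] c Bin.prems 1 obtain s2 where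
    2: "reach w (8 * S) P (ecost b) s1 s2" "pc s2 = pc s1 + ecost b" "mem s2 = mem s1"
    "regs s2 (Suc d) = ev b v A" "\<forall>r < Suc d. regs s2 r = regs s1 r" by auto
  let ?s = "exec w (Op f d d (Suc d)) s2"
  have "reach w (8 * S) P 1 s2 ?s"
    using o 1 2 by (auto intro!: reach_one)
  then have "reach w (8 * S) P (ecost (Bin f a b)) s ?s"
    using reach_trans[OF reach_trans[OF 1(1) 2(1)], of 1] by simp
  then show ?case
    using 1 2 Bin.prems by (intro exI[of _ ?s]) (auto simp: binop_val_arith)
next
  case (Arr k e)
  then have c: "code_at P (pc s) (compile_expr e d)"
    and o: "code_at P (pc s + ecost e)
      [Const (Suc d) k, Op Mul (Suc d) (Suc d) 31, Op Add d d (Suc d), Load d d]"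
    by (auto simp: code_at_append)
  from Arr.IH[OF c] Arr.prems obtain s1 where
    1: "reach w (8 * S) P (ecost e) s s1" "pc s1 = pc s + ecost e" "mem s1 = mem s"
    "regs s1 d = ev e v A" "\<forall>r < d. regs s1 r = regs s r" by auto
  define i where "i = ev e v A"
  have b: "k < 8" "i < S" using Arr.prems by (auto simp: i_def)
  note ab = address_bound[OF b]
  have r31: "regs s1 31 = S" using 1 Arr.prems by (auto simp: represents_def)
  have k: "k mod 2 ^ w = k" "k * S mod 2 ^ w = k * S" "(i + k * S) mod 2 ^ w = k * S + i"
    using ab b Arr.prems(5) by auto
  let ?s = "s1\<lparr>pc := Suc (Suc (Suc (Suc (pc s1)))), regs := (regs s1)(Suc d := k * S, d := mem s1 (k * S + i))\<rparr>"
  have "reach w (8 * S) P (Suc (Suc (Suc (Suc 0)))) s1 ?s"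
    apply (rule reach.further)
    using o 1 apply (simp add: code_at_Cons)
    using o 1 apply (simp add: code_at_Cons)
    apply (rule reach.further)
    using o 1 apply (simp add: code_at_Cons)
    using o 1 apply (simp add: code_at_Cons)
    apply (rule reach.further)
    using o 1 apply (simp add: code_at_Cons)
    using o 1 apply (simp add: code_at_Cons)
    apply (rule reach.further)
    using o 1 apply (simp add: code_at_Cons)
    using o 1 r31 k ab Arr.prems apply (simp add: code_at_Cons i_def[symmetric])
    using o 1 r31 k Arr.prems(2) by (simp add: code_at_Cons i_def[symmetric] reach.here fun_upd_twist)
  from reach_trans[OF 1(1) this] show ?case
    using 1 b Arr.prems
    by (intro exI[of _ ?s]) (auto simp: represents_def i_def numeral_eq_Suc)
qed

lemma compile_correct:
  assumes "big (2 ^ w) S c v A t v' A'" "code_at P (pc s) (compile c (pc s))"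
    "represents S v A s" "8 * S \<le> 2 ^ w"
  shows "\<exists>s'. reach w (8 * S) P t s s' \<and> pc s' = pc s + clen c \<and> represents S v' A' s'"
  using assms
proof (induction arbitrary: s rule: big.induct)
  case (Skip v A)
  then show ?case by (auto intro: reach.here)
next
  case (Assign e v A r)
  then obtain s1 where
    1: "reach w (8 * S) P (ecost e) s s1" "pc s1 = pc s + ecost e" "mem s1 = mem s"
    "regs s1 32 = ev e v A" "\<forall>r < 32. regs s1 r = regs s r"
    using compile_expr_correct[of P s e 32 S v A w] by (auto simp: code_at_append)
  let ?s = "exec w (Op Or r 32 32) s1"
  have "reach w (8 * S) P 1 s1 ?s"
    using Assign.prems 1 by (auto intro!: reach_one simp: code_at_append code_at_Cons)
  from reach_trans[OF 1(1) this] show ?case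
    using 1 Assign by (intro exI[of _ ?s]) (auto simp: represents_def)
next
  case (Put i v A e k)
  then have c: "code_at P (pc s) (compile_expr e 32)" "code_at P (pc s + ecost e) (compile_expr i 33)"
    and o: "code_at P (pc s + ecost e + ecost i)
      [Const 34 k, Op Mul 34 34 31, Op Add 33 33 34, Store 33 32]"
    by (auto simp: code_at_append)
  from compile_expr_correct[OF c(1), of S v A w] Put obtain s1 where
    1: "reach w (8 * S) P (ecost e) s s1" "pc s1 = pc s + ecost e" "mem s1 = mem s"
    "regs s1 32 = ev e v A" "\<forall>r < 32. regs s1 r = regs s r" by auto
  then have "represents S v A s1" using Put.prems by (auto simp: represents_def)
  with compile_expr_correct[of P s1 i 33 S v A w] c Put 1 obtain s2 where
    2: "reach w (8 * S) P (ecost i) s1 s2" "pc s2 = pc s1 + ecost i" "mem s2 = mem s1"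
    "regs s2 33 = ev i v A" "\<forall>r < 33. regs s2 r = regs s1 r" by auto
  note ab = address_bound[OF Put.hyps(3,4)]
  define j where "j = ev i v A"
  have k: "k mod 2 ^ w = k" "k * S mod 2 ^ w = k * S" "(j + k * S) mod 2 ^ w = k * S + j"
    using ab Put by (auto simp: j_def)
  have r31: "regs s2 31 = S" using 1 2 Put.prems by (auto simp: represents_def)
  have r32: "regs s2 32 = ev e v A" using 1 2 by auto
  let ?s = "s2\<lparr>regs := (regs s2)(34 := k * S, 33 := k * S + j), pc := Suc (Suc (Suc (Suc (pc s2)))),
     mem := (mem s2)(k * S + j := ev e v A)\<rparr>"
  have "reach w (8 * S) P (Suc (Suc (Suc (Suc 0)))) s2 ?s"
    apply (rule reach.further)
    using o 1 2 apply (simp add: code_at_Cons)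
    using o 1 2 apply (simp add: code_at_Cons)
    apply (rule reach.further)
    using o 1 2 apply (simp add: code_at_Cons)
    using o 1 2 apply (simp add: code_at_Cons)
    apply (rule reach.further)
    using o 1 2 apply (simp add: code_at_Cons)
    using o 1 2 apply (simp add: code_at_Cons)
    apply (rule reach.further)
    using o 1 2 apply (simp add: code_at_Cons)
    using o 1 2 r31 r32 k ab apply (simp add: code_at_Cons j_def[symmetric])
    using o 1 2 r31 r32 k by (simp add: code_at_Cons j_def[symmetric] reach.here fun_upd_twist)
  from reach_trans[OF reach_trans[OF 1(1) 2(1)] this]
  have "reach w (8 * S) P (ecost e + ecost i + 4) s ?s" by (simp add: eval_nat_numeral)
  \<comment> \<open>Dividing an address by \<open>S\<close> recovers the array, so the store changes
    a single cell of array \<open>k\<close> and nothing else.\<close>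
  moreover have "k' * S + i' = k * S + j \<longleftrightarrow> k' = k \<and> i' = j" if "i' < S" for k' i'
  proof
    assume *: "k' * S + i' = k * S + j"
    have "(k' * S + i') div S = k'" "(k * S + j) div S = k" using that Put by (auto simp: j_def)
    with * show "k' = k \<and> i' = j" by auto
  qed auto
  ultimately show ?case
    using 1 2 Put by (intro exI[of _ ?s]) (auto simp: represents_def j_def)
next
  case (Seq c v A t v' A' d t' v'' A'')
  then obtain s1 where "reach w (8 * S) P t s s1" "pc s1 = pc s + clen c" "represents S v' A' s1"
    using Seq.IH(1)[of s] by (auto simp: code_at_append)
  moreover from this obtain s2 where
    "reach w (8 * S) P t' s1 s2" "pc s2 = pc s1 + clen d" "represents S v'' A'' s2"
    using Seq.IH(2)[of s1] Seq.prems by (auto simp: code_at_append)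
  ultimately show ?case using reach_trans by (fastforce simp: add.assoc)
next
  case (IfT e v A c t v' A' d)
  then obtain s1 where
    1: "reach w (8 * S) P (ecost e) s s1" "pc s1 = pc s + ecost e" "mem s1 = mem s"
    "regs s1 32 = ev e v A" "\<forall>r < 32. regs s1 r = regs s r"
    using compile_expr_correct[of P s e 32 S v A w] by (auto simp: code_at_append)
  let ?s = "s1\<lparr>pc := pc s1 + 1\<rparr>"
  have 2: "reach w (8 * S) P 1 s1 ?s"
    using IfT 1 by (auto intro!: reach_one simp: code_at_append code_at_Cons)
  have "represents S v A ?s" using IfT.prems 1 by (auto simp: represents_def)
  then obtain s2 where
    3: "reach w (8 * S) P t ?s s2" "pc s2 = pc ?s + clen c" "represents S v' A' s2"
    using IfT.IH[of ?s] IfT.prems 1 by (auto simp: code_at_append code_at_Cons)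
  let ?s2 = "s2\<lparr>pc := pc s + clen (If e c d)\<rparr>"
  have 4: "reach w (8 * S) P 1 s2 ?s2"
    using IfT.prems 1 3 by (auto intro!: reach_one simp: code_at_append code_at_Cons algebra_simps)
  from reach_trans[OF reach_trans[OF reach_trans[OF 1(1) 2] 3(1)] 4]
  have "reach w (8 * S) P (ecost e + 2 + t) s ?s2" by (simp add: algebra_simps)
  moreover have "represents S v' A' ?s2" using 3 by (simp add: represents_def)
  ultimately show ?case by (intro exI[of _ ?s2]) simp
next
  case (IfF e v A d t v' A' c)
  then obtain s1 where
    1: "reach w (8 * S) P (ecost e) s s1" "pc s1 = pc s + ecost e" "mem s1 = mem s"
    "regs s1 32 = ev e v A" "\<forall>r < 32. regs s1 r = regs s r"
    using compile_expr_correct[of P s e 32 S v A w] by (auto simp: code_at_append)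
  let ?s = "s1\<lparr>pc := pc s + ecost e + clen c + 2\<rparr>"
  have 2: "reach w (8 * S) P 1 s1 ?s"
    using IfF 1 by (auto intro!: reach_one simp: code_at_append code_at_Cons)
  have "represents S v A ?s" using IfF.prems 1 by (auto simp: represents_def)
  then obtain s2 where
    3: "reach w (8 * S) P t ?s s2" "pc s2 = pc ?s + clen d" "represents S v' A' s2"
    using IfF.IH[of ?s] IfF.prems 1 by (auto simp: code_at_append code_at_Cons algebra_simps)
  from reach_trans[OF reach_trans[OF 1(1) 2] 3(1)]
  have "reach w (8 * S) P (ecost e + 1 + t) s s2" by (simp add: algebra_simps)
  with 3 show ?case by (intro exI[of _ s2]) simp
next
  case (WhileF e v A c)
  then obtain s1 where
    1: "reach w (8 * S) P (ecost e) s s1" "pc s1 = pc s + ecost e" "mem s1 = mem s"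
    "regs s1 32 = ev e v A" "\<forall>r < 32. regs s1 r = regs s r"
    using compile_expr_correct[of P s e 32 S v A w] by (auto simp: code_at_append)
  let ?s = "s1\<lparr>pc := pc s + ecost e + clen c + 2\<rparr>"
  have 2: "reach w (8 * S) P 1 s1 ?s"
    using WhileF 1 by (auto intro!: reach_one simp: code_at_append code_at_Cons)
  have "represents S v A ?s" using WhileF.prems 1 by (auto simp: represents_def)
  with reach_trans[OF 1(1) 2] show ?case by (intro exI[of _ ?s]) simp
next
  case (WhileT e v A c t v' A' t' v'' A'')
  then obtain s1 where
    1: "reach w (8 * S) P (ecost e) s s1" "pc s1 = pc s + ecost e" "mem s1 = mem s"
    "regs s1 32 = ev e v A" "\<forall>r < 32. regs s1 r = regs s r"
    using compile_expr_correct[of P s e 32 S v A w] by (auto simp: code_at_append)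
  let ?s = "s1\<lparr>pc := pc s1 + 1\<rparr>"
  have 2: "reach w (8 * S) P 1 s1 ?s"
    using WhileT 1 by (auto intro!: reach_one simp: code_at_append code_at_Cons)
  have "represents S v A ?s" using WhileT.prems 1 by (auto simp: represents_def)
  then obtain s2 where
    3: "reach w (8 * S) P t ?s s2" "pc s2 = pc ?s + clen c" "represents S v' A' s2"
    using WhileT.IH(1)[of ?s] WhileT.prems 1 by (auto simp: code_at_append code_at_Cons)
  let ?s2 = "s2\<lparr>pc := pc s\<rparr>"
  have 4: "reach w (8 * S) P 1 s2 ?s2"
    using WhileT.prems 1 3 by (auto intro!: reach_one simp: code_at_append code_at_Cons)
  have "represents S v' A' ?s2" using 3 by (simp add: represents_def)
  then obtain s3 where
    5: "reach w (8 * S) P t' ?s2 s3" "pc s3 = pc ?s2 + clen (While e c)" "represents S v'' A'' s3"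
    using WhileT.IH(2)[of ?s2] WhileT.prems by auto
  from reach_trans[OF reach_trans[OF reach_trans[OF reach_trans[OF 1(1) 2] 3(1)] 4] 5(1)]
  have "reach w (8 * S) P (ecost e + 2 + t + t') s s3" by (simp add: algebra_simps)
  with 5 show ?case by (intro exI[of _ s3]) simp
qed

lemma run_halted: "halted P s \<Longrightarrow> run w P t s = s"
  by (induction t) (auto simp: run_def step_def)

text \<open>Halted states are fixed points of \<open>step\<close>, so the state after
  \<open>t\<close> steps is the one at the least halting time, even if that is earlier.\<close>

lemma reach_halts:
  assumes "reach w b P t s s'" "halted P s'"
  shows "halts w P s \<and> run_time w P s \<le> t \<and> final_state w P s = s' \<and> run_space w P s \<le> b"
proof -
  from reach_run[OF assms(1)] have r: "run w P t s = s'"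
    and a: "\<forall>u < t. \<forall>a \<in> accessed (P ! pc (run w P u s)) (run w P u s). a < b" by auto
  have le: "run_time w P s \<le> t" unfolding run_time_def by (rule Least_le) (simp add: r assms)
  have h: "halted P (run w P (run_time w P s) s)" unfolding run_time_def
    by (rule LeastI[of _ t]) (simp add: r assms)
  have "run w P t s = run w P (t - run_time w P s) (run w P (run_time w P s) s)"
    unfolding run_def using le by (simp flip: funpow_add[unfolded o_def, THEN fun_cong])
  with run_halted[OF h] r have "final_state w P s = s'" by (simp add: final_state_def)
  moreover have "run_space w P s \<le> b" unfolding run_space_def
    using a le by (intro Least_le) (meson order_less_le_trans)
  moreover have "halts w P s" unfolding halts_def using h by blast
  ultimately show ?thesis using le by simp
qed

section \<open>Weakest preconditions with a running-time counter\<close>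

text \<open>\<open>T\<close> is the time spent before \<open>c\<close>. Threading it through lets
  loop invariants bound the total time like any other quantity; the existential quantifier demands
  termination.\<close>

definition wp :: "nat \<Rightarrow> nat \<Rightarrow> com \<Rightarrow> (vars \<Rightarrow> arrays \<Rightarrow> nat \<Rightarrow> bool) \<Rightarrow> vars \<Rightarrow> arrays \<Rightarrow> nat \<Rightarrow> bool" where
  "wp W S c Q v A T \<longleftrightarrow> (\<exists>t v' A'. big W S c v A t v' A' \<and> Q v' A' (T + t))"

lemma wp_Skip [simp]: "wp W S Skip Q v A T \<longleftrightarrow> Q v A T"
  unfolding wp_def by (auto elim!: SkipE) (metis add_0_right big.Skip)

lemma wp_Assign [simp]:
  "wp W S (r ::= e) Q v A T \<longleftrightarrow> safe W S e v A \<and> r < 31 \<and> Q (v(r := ev e v A)) A (T + (ecost e + 1))"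
  unfolding wp_def by (auto elim!: AssignE intro!: exI big.Assign)

lemma wp_Put [simp]:
  "wp W S (Put k i e) Q v A T \<longleftrightarrow> safe W S i v A \<and> safe W S e v A \<and> k < 8 \<and> ev i v A < S \<and>
     Q v (A(k := (A k)(ev i v A := ev e v A))) (T + (ecost e + ecost i + 4))"
  unfolding wp_def by (auto elim!: PutE intro!: exI big.Put)

lemma wp_Seq [simp]: "wp W S (c ;; d) Q v A T \<longleftrightarrow> wp W S c (wp W S d Q) v A T"
  unfolding wp_def by (fastforce elim: SeqE intro: big.Seq simp: add.assoc)

lemma wp_If [simp]:
  "wp W S (If e c d) Q v A T \<longleftrightarrow> safe W S e v A \<and>
     (if ev e v A \<noteq> 0 then wp W S c Q v A (T + (ecost e + 2))
      else wp W S d Q v A (T + (ecost e + 1)))"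
  (is "?L \<longleftrightarrow> ?R")
proof
  show "?L \<Longrightarrow> ?R" unfolding wp_def by (auto elim!: IfE simp: add.assoc) blast+
next
  assume ?R
  then show ?L
    unfolding wp_def by (cases "ev e v A = 0") (use IfT IfF in \<open>fastforce simp: add.assoc\<close>)+
qed

lemma wp_mono:
  "wp W S c Q v A T \<Longrightarrow> (\<And>v A T. Q v A T \<Longrightarrow> R v A T) \<Longrightarrow> wp W S c R v A T"
  unfolding wp_def by blast

lemma wp_While_unfold:
  assumes "safe W S e v A"
    "ev e v A = 0 \<Longrightarrow> Q v A (T + (ecost e + 1))"
    "ev e v A \<noteq> 0 \<Longrightarrow> wp W S c (wp W S (While e c) Q) v A (T + (ecost e + 2))"
  shows "wp W S (While e c) Q v A T"
proof (cases "ev e v A = 0")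
  case True
  with assms show ?thesis unfolding wp_def by (blast intro: big.intros)
next
  case False
  from assms(3)[OF this] obtain t v' A' t' v'' A'' where
    1: "big W S c v A t v' A'" "big W S (While e c) v' A' t' v'' A''"
    "Q v'' A'' (T + (ecost e + 2) + t + t')"
    unfolding wp_def by blast
  from big.WhileT[OF assms(1) False 1(1,2)] 1(3) show ?thesis
    unfolding wp_def by (metis add.assoc)
qed

lemma wp_While:
  fixes M :: "vars \<Rightarrow> arrays \<Rightarrow> nat"
  assumes "I v A T"
    and "\<And>v A T. I v A T \<Longrightarrow> safe W S e v A"
    and "\<And>v A T. I v A T \<Longrightarrow> ev e v A = 0 \<Longrightarrow> Q v A (T + (ecost e + 1))"
    and "\<And>v A T. I v A T \<Longrightarrow> ev e v A \<noteq> 0 \<Longrightarrow>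
      wp W S c (\<lambda>v' A' T'. I v' A' T' \<and> M v' A' < M v A) v A (T + (ecost e + 2))"
  shows "wp W S (While e c) Q v A T"
  using assms(1)
proof (induction "M v A" arbitrary: v A T rule: less_induct)
  case less
  then show ?case
    using assms(2)[OF less.prems] assms(3)[OF less.prems] assms(4)[OF less.prems]
    by (intro wp_While_unfold) (auto elim!: wp_mono)
qed

text \<open>For loops along a linked list: the list still to be visited indexes the invariant and is
  the termination measure, as no register holds one.\<close>

lemma wp_While_list:
  assumes "I L v A T"
    and "\<And>L v A T. I L v A T \<Longrightarrow> safe W S e v A"
    and "\<And>v A T. I [] v A T \<Longrightarrow> ev e v A = 0 \<and> Q v A (T + (ecost e + 1))"
    and "\<And>a L v A T. I (a # L) v A T \<Longrightarrow> ev e v A \<noteq> 0 \<and> wp W S c (I L) v A (T + (ecost e + 2))"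
  shows "wp W S (While e c) Q v A T"
  using assms(1)
proof (induction L arbitrary: v A T)
  case Nil
  with assms(2,3) show ?case by (intro wp_While_unfold) auto
next
  case (Cons a L)
  then show ?case
    using assms(2)[OF Cons.prems] assms(4)[OF Cons.prems] wp_mono[OF _ Cons.IH]
    by (intro wp_While_unfold) auto
qed

section \<open>Letter ranks and window codes\<close>

definition rank :: "nat list \<Rightarrow> nat \<Rightarrow> nat" where
  "rank x c = card {d \<in> set x. d < c}"

lemma rank_Suc: "rank x (Suc c) = rank x c + of_bool (c \<in> set x)"
proof -
  have "{d \<in> set x. d < Suc c} = {d \<in> set x. d < c} \<union> (if c \<in> set x then {c} else {})"
    by (auto simp: less_Suc_eq)
  then show ?thesis unfolding rank_def by (auto simp: card_insert_if)
qed

lemma rank_mono: "c \<le> d \<Longrightarrow> rank x c \<le> rank x d"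
  unfolding rank_def by (intro card_mono) auto

lemma rank_less: "c \<in> set x \<Longrightarrow> rank x c < card (set x)"
  unfolding rank_def by (intro psubset_card_mono) auto

text \<open>\<open>rank\<close> increases right after each letter that occurs, which separates
  different letters of the string.\<close>

lemma rank_inj: "c \<in> set x \<Longrightarrow> d \<in> set x \<Longrightarrow> rank x c = rank x d \<Longrightarrow> c = d"
  using rank_Suc[of x c] rank_Suc[of x d] rank_mono[of "Suc c" d x] rank_mono[of "Suc d" c x]
  by (cases c d rule: linorder_cases) auto

lemma rank_all: "set x \<subseteq> {1..n} \<Longrightarrow> rank x (Suc n) = card (set x)"
  unfolding rank_def by (rule arg_cong[where f = card]) auto

text \<open>Positions are counted from 1, so that 0 can serve as the null pointer. Beyond the end of the
  string the digits are 0.\<close>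

definition digit :: "nat list \<Rightarrow> nat \<Rightarrow> nat" where
  "digit x i = (if 1 \<le> i \<and> i \<le> length x then rank x (x ! (i - 1)) else 0)"

definition code :: "nat list \<Rightarrow> nat \<Rightarrow> nat \<Rightarrow> nat" where
  "code x l i = (\<Sum>t<l. digit x (i + t) * card (set x) ^ (l - 1 - t))"

lemma digit_less: "x \<noteq> [] \<Longrightarrow> digit x i < card (set x)"
  by (auto simp: digit_def rank_less card_gt_0_iff)

lemma div_digit: "d < (s::nat) \<Longrightarrow> (a * s + d) div s = a"
  by (cases "s = 0") auto

lemma digit_eq_iff:
  assumes "1 \<le> i" "i \<le> length x" "1 \<le> j" "j \<le> length x"
  shows "digit x i = digit x j \<longleftrightarrow> x ! (i - 1) = x ! (j - 1)"
  using assms rank_inj[of "x ! (i - 1)" x "x ! (j - 1)"] by (auto simp: digit_def)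

lemma code_Suc: "code x (Suc l) i = code x l i * card (set x) + digit x (i + l)"
proof -
  have "digit x (i + t) * card (set x) ^ (l - t) =
      digit x (i + t) * card (set x) ^ (l - 1 - t) * card (set x)" if "t < l" for t
  proof -
    have "l - t = Suc (l - 1 - t)" using that by simp
    then show ?thesis by (metis power_Suc2 mult.assoc)
  qed
  then have "(\<Sum>t<l. digit x (i + t) * card (set x) ^ (l - t)) = code x l i * card (set x)"
    unfolding code_def sum_distrib_right by (intro sum.cong) auto
  then show ?thesis by (simp add: code_def)
qed

lemma code_Suc': "code x (Suc l) i = digit x i * card (set x) ^ l + code x l (Suc i)"
  unfolding code_def by (subst sum.lessThan_Suc_shift) simp

lemma code_less: "x \<noteq> [] \<Longrightarrow> code x l i < card (set x) ^ l"
proof (induction l)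
  case 0
  then show ?case by (simp add: code_def)
next
  case (Suc l)
  then have "Suc (code x l i) \<le> card (set x) ^ l" by simp
  from mult_right_mono[OF this, of "card (set x)"] digit_less[OF Suc.prems, of "i + l"]
  show ?case by (simp add: code_Suc mult.commute)
qed

text \<open>Moving the window one place to the left: division by the base drops the last digit, and
  the new leading digit enters with weight \<open>s ^ (l - 1)\<close>. A scan from right to left
  thus yields every code in constant time.\<close>

lemma code_rec:
  assumes "x \<noteq> []" "1 \<le> l"
  shows "code x l i = code x l (Suc i) div card (set x) + digit x i * card (set x) ^ (l - 1)"
proof -
  obtain k where k: "l = Suc k" using assms by (cases l) auto
  have "code x (Suc k) (Suc i) div card (set x) = code x k (Suc i)"
    using digit_less[OF assms(1), of "Suc i + k"] by (simp add: code_Suc div_digit)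
  then show ?thesis unfolding k by (simp add: code_Suc')
qed

lemma code_beyond: "length x < i \<Longrightarrow> code x l i = 0"
  by (auto simp: code_def digit_def)

text \<open>Remainder and quotient by the base split off the last digit.\<close>

lemma code_eq_iff:
  assumes "x \<noteq> []"
  shows "code x l i = code x l j \<longleftrightarrow> (\<forall>t<l. digit x (i + t) = digit x (j + t))"
proof (induction l)
  case 0
  then show ?case by (simp add: code_def)
next
  case (Suc l)
  let ?s = "card (set x)"
  have "code x (Suc l) i = code x (Suc l) j \<longleftrightarrow>
      code x l i = code x l j \<and> digit x (i + l) = digit x (j + l)"
  proof
    assume "code x (Suc l) i = code x (Suc l) j"
    then have "code x (Suc l) i div ?s = code x (Suc l) j div ?s"
      "code x (Suc l) i mod ?s = code x (Suc l) j mod ?s" by simp_all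
    with digit_less[OF assms, of "i + l"] digit_less[OF assms, of "j + l"]
    show "code x l i = code x l j \<and> digit x (i + l) = digit x (j + l)"
      by (simp add: code_Suc div_digit)
  qed (simp add: code_Suc)
  with Suc.IH show ?case by (auto simp: less_Suc_eq)
qed

section \<open>Linked lists\<close>

fun linked :: "(nat \<Rightarrow> nat) \<Rightarrow> nat \<Rightarrow> nat list \<Rightarrow> bool" where
  "linked f p [] \<longleftrightarrow> p = 0"
| "linked f p (a # L) \<longleftrightarrow> p = a \<and> a \<noteq> 0 \<and> linked f (f a) L"

lemma linked_upd: "i \<notin> set L \<Longrightarrow> linked (f(i := z)) p L \<longleftrightarrow> linked f p L"
  by (induction L arbitrary: p) auto

lemma linked_zero [simp]: "linked f 0 L \<longleftrightarrow> L = []"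
  by (cases L) auto

text \<open>\<open>R\<close> lists the processed positions, latest first.\<close>

fun same_key_links :: "(nat \<Rightarrow> nat) \<Rightarrow> (nat \<Rightarrow> nat) \<Rightarrow> nat list \<Rightarrow> bool" where
  "same_key_links D f [] \<longleftrightarrow> True"
| "same_key_links D f (j # R) \<longleftrightarrow>
     linked f (f j) (filter (\<lambda>k. D k = D j) R) \<and> same_key_links D f R"

lemma same_key_links_upd:
  "j \<notin> set R \<Longrightarrow> same_key_links D (f(j := z)) R \<longleftrightarrow> same_key_links D f R"
  by (induction R) (auto simp: linked_upd)

text \<open>The 0 for the empty list is the null pointer, and also the initial content of array
  6.\<close>

definition first :: "nat list \<Rightarrow> nat" where
  "first L = (case L of [] \<Rightarrow> 0 | a # _ \<Rightarrow> a)"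

text \<open>As positions are processed in the order of \<open>D k div n\<close>, the latest position with a given
  \<open>D k mod n\<close> has the key of \<open>j\<close> unless no processed position has.\<close>

lemma linked_first:
  assumes "0 \<notin> set R" "same_key_links D f R" "\<forall>k \<in> set R. D k div n \<le> D j div n"
    "sorted_wrt (\<lambda>a b. D b div n \<le> D a div n) R"
    "c = first (filter (\<lambda>k. D k mod n = D j mod n) R)"
  shows "linked f (c * of_bool (D c = D j)) (filter (\<lambda>k. D k = D j) R)"
  using assms
proof (induction R)
  case Nil
  then show ?case by (simp add: first_def)
next
  case (Cons a R)
  show ?case
  proof (cases "D a mod n = D j mod n")
    case True
    then have c: "c = a" using Cons.prems by (simp add: first_def)
    show ?thesis
    proof (cases "D a = D j")
      case True
      with c Cons.prems show ?thesis by auto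
    next
      case False
      \<comment> \<open>With equal remainders, different keys have different quotients. By the order
        of \<open>R\<close> all processed quotients then lie below that of \<open>j\<close>, so no
        processed position has its key.\<close>
      then have "D a div n \<noteq> D j div n" using \<open>D a mod n = D j mod n\<close>
        by (metis div_mult_mod_eq)
      then have "D a div n < D j div n" using Cons.prems by auto
      then have "D k div n < D j div n" if "k \<in> set R" for k
        using that Cons.prems by fastforce
      then have "D k \<noteq> D j" if "k \<in> set R" for k
        using that by (metis less_irrefl)
      then have "filter (\<lambda>k. D k = D j) R = []" by (simp add: filter_empty_conv)
      with c False show ?thesis by simp
    qed
  next
    case False
    then have "D a \<noteq> D j" by auto
    with False Cons show ?thesis by auto
  qed
qed

text \<open>The chain of a position holds the positions of equal key processed before it. So of two
  positions of equal key exactly one sees the other, and following all chains visits each unordered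
  pair once.\<close>

lemma same_key_chains:
  assumes "same_key_links D f R" "distinct R"
  shows "\<exists>ch. (\<forall>j \<in> set R. linked f (f j) (ch j) \<and> distinct (ch j) \<and>
        set (ch j) \<subseteq> {k \<in> set R. k \<noteq> j \<and> D k = D j}) \<and>
      (\<forall>j \<in> set R. \<forall>k \<in> set R. j \<noteq> k \<longrightarrow> D j = D k \<longrightarrow> (k \<in> set (ch j)) \<noteq> (j \<in> set (ch k)))"
  using assms
proof (induction R)
  case Nil
  then show ?case by simp
next
  case (Cons a R)
  then have "same_key_links D f R" "distinct R" by auto
  from Cons.IH[OF this] obtain ch where
    1: "\<And>j. j \<in> set R \<Longrightarrow> linked f (f j) (ch j) \<and> distinct (ch j) \<and>
      set (ch j) \<subseteq> {k \<in> set R. k \<noteq> j \<and> D k = D j}" and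
    2: "\<And>j k. j \<in> set R \<Longrightarrow> k \<in> set R \<Longrightarrow> j \<noteq> k \<Longrightarrow> D j = D k \<Longrightarrow>
      (k \<in> set (ch j)) \<noteq> (j \<in> set (ch k))"
    by (elim exE conjE) blast
  define g where "g = ch(a := filter (\<lambda>k. D k = D a) R)"
  have ga: "g a = filter (\<lambda>k. D k = D a) R" "\<And>j. j \<in> set R \<Longrightarrow> g j = ch j"
    using Cons.prems by (auto simp: g_def)
  have "linked f (f j) (g j) \<and> distinct (g j) \<and> set (g j) \<subseteq> {k \<in> set (a # R). k \<noteq> j \<and> D k = D j}"
    if "j \<in> set (a # R)" for j
    using that 1[of j] ga Cons.prems by (cases "j = a") auto
  moreover have "(k \<in> set (g j)) \<noteq> (j \<in> set (g k))"
    if *: "j \<in> set (a # R)" "k \<in> set (a # R)" "j \<noteq> k" "D j = D k" for j k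
  proof -
    consider "j = a" "k \<in> set R" | "j \<in> set R" "k = a" | "j \<in> set R" "k \<in> set R" using * by auto
    then show ?thesis
      by cases (use ga * 1[of k] 1[of j] 2[of j k] Cons.prems in auto)
  qed
  ultimately show ?case by (intro exI[of _ g]) blast
qed

section \<open>The program\<close>

abbreviation (input) "rN \<equiv> 0 :: nat"
abbreviation (input) "rM \<equiv> 1 :: nat"
abbreviation (input) "rS \<equiv> 2 :: nat"
abbreviation (input) "rH \<equiv> 3 :: nat"
abbreviation (input) "rL \<equiv> 4 :: nat"
abbreviation (input) "rB \<equiv> 5 :: nat"
abbreviation (input) "rI \<equiv> 6 :: nat"
abbreviation (input) "rC \<equiv> 7 :: nat"
abbreviation (input) "rT \<equiv> 8 :: nat"
abbreviation (input) "rE \<equiv> 9 :: nat"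
abbreviation (input) "rU \<equiv> 10 :: nat"
abbreviation (input) "rJ \<equiv> 11 :: nat"
abbreviation (input) "rO \<equiv> 12 :: nat"
abbreviation (input) "rLen \<equiv> 13 :: nat"
abbreviation (input) "rR \<equiv> 14 :: nat"
abbreviation (input) "rRl \<equiv> 15 :: nat"
abbreviation (input) "rK \<equiv> 16 :: nat"
abbreviation (input) "rQ \<equiv> 17 :: nat"

abbreviation (input) e_add (infixl "[+]" 65) where "a [+] b \<equiv> Bin Add a b"
abbreviation (input) e_sub (infixl "[-]" 65) where "a [-] b \<equiv> Bin Sub a b"
abbreviation (input) e_mul (infixl "[*]" 70) where "a [*] b \<equiv> Bin Mul a b"
abbreviation (input) e_div (infixl "[div]" 70) where "a [div] b \<equiv> Bin Div a b"
abbreviation (input) e_mod (infixl "[mod]" 70) where "a [mod] b \<equiv> Bin Mod a b"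
abbreviation (input) e_less (infix "[<]" 50) where "a [<] b \<equiv> Bin Less a b"
abbreviation (input) e_eq (infix "[=]" 50) where "a [=] b \<equiv> Bin Equal a b"

text \<open>Array 0 is the string and later the output, 1 the ranks of the letters, 2 the digits, and 3
  the window codes. Arrays 4 and 5 are the heads and links of the lists of positions by
  \<open>code div n\<close>. Array 6 gives the last position so far by \<open>code mod n\<close>, and array 7 links positions
  of equal code.\<close>

definition presence :: com where
  "presence =
     rI ::= Lit 0 ;;
     While (Var rI [<] Var rN)
       (Put 1 (Arr 0 (Var rI)) (Lit 1) ;; rI ::= Var rI [+] Lit 1)"

text \<open>Prefix sums turn the presence bits into ranks in place; their total is the number of
  letters that occur.\<close>

definition ranking :: com where
  "ranking =
     rS ::= Lit 0 ;; rI ::= Lit 0 ;;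
     While (Var rI [<] Var rN [+] Lit 1)
       (rT ::= Arr 1 (Var rI) ;; Put 1 (Var rI) (Var rS) ;; rS ::= Var rS [+] Var rT ;;
        rI ::= Var rI [+] Lit 1)"

text \<open>\<open>rB\<close> holds \<open>s ^ (rL - 1)\<close>, the weight of the leading digit.
  Conjunction is expressed by multiplying truth values, so both factors are always
  evaluated.\<close>

definition window_length :: com where
  "window_length =
     rH ::= Var rM [div] Lit 2 ;; rL ::= Lit 1 ;; rB ::= Lit 1 ;;
     While ((Var rL [<] Var rH) [*] (Var rB [*] Var rS [<] Var rN))
       (rL ::= Var rL [+] Lit 1 ;; rB ::= Var rB [*] Var rS)"

text \<open>Each letter is erased after its last use, so that array 0 can start as an all-zero
  output array.\<close>

definition coding :: com where
  "coding =
     rI ::= Var rN ;; rC ::= Lit 0 ;;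
     While (Var rI)
       (rT ::= Arr 1 (Arr 0 (Var rI [-] Lit 1)) ;;
        rC ::= Var rC [div] Var rS [+] Var rT [*] Var rB ;;
        Put 2 (Var rI) (Var rT) ;; Put 3 (Var rI) (Var rC) ;; Put 0 (Var rI [-] Lit 1) (Lit 0) ;;
        rI ::= Var rI [-] Lit 1)"

definition buckets :: com where
  "buckets =
     rE ::= Var rN [-] Var rL [+] Lit 1 ;; rI ::= Lit 1 ;;
     While (Var rI [<] Var rE [+] Lit 1)
       (rT ::= Arr 3 (Var rI) [div] Var rN ;; Put 5 (Var rI) (Arr 4 (Var rT)) ;;
        Put 4 (Var rT) (Var rI) ;; rI ::= Var rI [+] Lit 1)"

text \<open>Multiplying by the truth value gives the null link when the codes differ. For
  \<open>rC = 0\<close> the result is 0 whatever cell 0 of array 3 holds.\<close>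

definition link_bucket :: com where
  "link_bucket =
     While (Var rJ)
       (rT ::= Arr 3 (Var rJ) [mod] Var rN ;; rC ::= Arr 6 (Var rT) ;;
        Put 7 (Var rJ) (Var rC [*] (Arr 3 (Var rC) [=] Arr 3 (Var rJ))) ;;
        Put 6 (Var rT) (Var rJ) ;; rJ ::= Arr 5 (Var rJ))"

definition linking :: com where
  "linking =
     rU ::= Lit 0 ;;
     While (Var rU [<] Var rN)
       (rJ ::= Arr 4 (Var rU) ;; link_bucket ;; rU ::= Var rU [+] Lit 1)"

definition mismatches :: com where
  "mismatches =
     rQ ::= Lit 0 ;; rT ::= Lit 0 ;;
     While (Var rT [<] Var rRl)
       (rQ ::= Var rQ [+] (Lit 1 [-]
          (Arr 2 (Var rJ [-] Var rO [+] Var rR [+] Var rT) [=]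
           Arr 2 (Var rK [-] Var rO [+] Var rR [+] Var rT))) ;;
        rT ::= Var rT [+] Lit 1)"

text \<open>Windows are counted from 1 and factors from 0: the window at \<open>p\<close> lies at
  offset \<open>rO\<close> of the factor starting at \<open>p - rO - 1\<close>.\<close>

definition bump :: "nat \<Rightarrow> com" where
  "bump p = Put 0 (Var p [-] Var rO [-] Lit 1) (Arr 0 (Var p [-] Var rO [-] Lit 1) [+] Lit 1)"

text \<open>Equal codes already guarantee \<open>l\<close> common letters, hence the start at
  \<open>rL\<close>.\<close>

definition extend :: com where
  "extend =
     rT ::= Var rL ;;
     While ((Var rT [<] Var rLen) [*] (Arr 2 (Var rJ [+] Var rT) [=] Arr 2 (Var rK [+] Var rT)))
       (rT ::= Var rT [+] Lit 1)"

text \<open>Registers \<open>rJ\<close> and \<open>rK\<close> hold the starts of two windows with equal codes, seen as lying at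
  offset \<open>rO\<close> of two factors. The half to be matched has length \<open>rLen\<close>; the other half consists
  of the \<open>rRl\<close> positions of the factors from \<open>rR\<close> on.\<close>

definition verify :: com where
  "verify =
     If ((Var rO [<] Var rJ) [*] (Var rJ [<] Var rO [+] (Var rN [-] Var rM [+] Lit 2)) [*]
         ((Var rO [<] Var rK) [*] (Var rK [<] Var rO [+] (Var rN [-] Var rM [+] Lit 2))))
       (extend ;;
        If (Var rT [<] Var rLen) Skip
          (mismatches ;; If (Var rQ [=] Lit 1) (bump rJ ;; bump rK) Skip))
       Skip"

definition walk :: com where
  "walk = While (Var rK) (verify ;; rK ::= Arr 7 (Var rK))"

definition pairs :: com where
  "pairs =
     rJ ::= Lit 1 ;;
     While (Var rJ [<] Var rE [+] Lit 1)
       (rK ::= Arr 7 (Var rJ) ;; walk ;; rJ ::= Var rJ [+] Lit 1)"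

text \<open>The links are built once and serve both passes, which differ only in the offsets and
  lengths of the two halves.\<close>

definition main :: com where
  "main =
     coding ;; buckets ;; linking ;;
     rO ::= Lit 0 ;; rLen ::= Var rH ;; rR ::= Var rH ;; rRl ::= Var rM [-] Var rH ;; pairs ;;
     rO ::= Var rH ;; rLen ::= Var rM [-] Var rH ;; rR ::= Lit 0 ;; rRl ::= Var rH ;; pairs"

definition prog :: com where
  "prog = presence ;; ranking ;; window_length ;; main"

section \<open>Correctness of the preprocessing\<close>

text \<open>The bound on \<open>W\<close> leaves room for codes below \<open>n * n\<close>, for
  products of two numbers up to \<open>S\<close>, and for the output counters, which are kept below
  multiples of \<open>S * S\<close>.\<close>

locale mapp =
  fixes x :: "nat list" and m W :: nat
  assumes letters: "set x \<subseteq> {1..length x}"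
    and m2: "2 \<le> m" and m_less: "m < length x"
    and W: "64 * ((length x + 2) * (length x + 2)) \<le> W"
begin

abbreviation "n \<equiv> length x"
abbreviation "S \<equiv> n + 2"
abbreviation "s \<equiv> card (set x)"
abbreviation "h \<equiv> m div 2"

lemma x_ne: "x \<noteq> []"
  using m_less by auto

lemma W_lin: "100 * S \<le> W"
proof -
  have "4 * S \<le> S * S" using m2 m_less by (intro mult_right_mono) auto
  with W show ?thesis by linarith
qed

lemma W_prod: "a \<le> S \<Longrightarrow> b \<le> S \<Longrightarrow> c \<le> 30 * (S * S) \<Longrightarrow> c + a * b < W"
proof -
  assume "a \<le> S" "b \<le> S" "c \<le> 30 * (S * S)"
  moreover have "a * b \<le> S * S" using \<open>a \<le> S\<close> \<open>b \<le> S\<close> by (rule mult_le_mono)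
  moreover have "0 < S * S" by simp
  ultimately show ?thesis using W by linarith
qed

lemma s_le: "s \<le> n"
  by (rule card_length)

lemma letter_le: "i < n \<Longrightarrow> x ! i \<le> n"
  using letters nth_mem by fastforce

definition init :: arrays where
  "init k i = (if k = 0 \<and> i < n then x ! i else 0)"

lemma wp_presence:
  assumes v: "v rN = n" "v rM = m" and A: "A = init"
    and Q: "\<And>v' A' T'. v' rN = n \<Longrightarrow> v' rM = m \<Longrightarrow> \<forall>k. k \<noteq> 1 \<longrightarrow> A' k = init k \<Longrightarrow>
      \<forall>c. A' 1 c = of_bool (c \<in> set x) \<Longrightarrow> T' \<le> T + 50 * n + 50 \<Longrightarrow> Q v' A' T'"
  shows "wp W S presence Q v A T"
  unfolding presence_def wp_Seq wp_Assign
proof (intro conjI)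
  let ?I = "\<lambda>v A T'. v rN = n \<and> v rM = m \<and> v rI \<le> n \<and> (\<forall>k. k \<noteq> 1 \<longrightarrow> A k = init k) \<and>
     (\<forall>c. A 1 c = of_bool (c \<in> set (take (v rI) x))) \<and> T' \<le> T + 10 + 30 * v rI"
  let ?v = "v(rI := ev (Lit 0) v A)"
  show "wp W S (While (Var rI [<] Var rN) (Put 1 (Arr 0 (Var rI)) (Lit 1) ;; rI ::= Var rI [+] Lit 1))
    Q ?v A (T + (ecost (Lit 0) + 1))"
  proof (rule wp_While[where I = ?I and M = "\<lambda>v A. n - v rI"], goal_cases)
    case 1
    then show ?case using v A by (auto simp: init_def)
  next
    case (2 v A T)
    then show ?case using W_lin by auto
  next
    case (3 v A T)
    then have "v rI = n" by auto
    with 3 show ?case by (intro Q) auto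
  next
    case (4 v A T)
    then have "v rI < n" by (auto split: if_splits)
    with 4 W_lin letter_le[of "v rI"] show ?case
      by (auto simp: init_def take_Suc_conv_app_nth)
  qed
qed (use W_lin in auto)

lemma wp_ranking:
  assumes v: "v rN = n" "v rM = m" and A: "\<forall>k. k \<noteq> 1 \<longrightarrow> A k = init k"
    "\<forall>c. A 1 c = of_bool (c \<in> set x)"
    and Q: "\<And>v' A' T'. v' rN = n \<Longrightarrow> v' rM = m \<Longrightarrow> v' rS = s \<Longrightarrow> \<forall>k. k \<noteq> 1 \<longrightarrow> A' k = init k \<Longrightarrow>
      \<forall>c \<le> n. A' 1 c = rank x c \<Longrightarrow> T' \<le> T + 50 * n + 100 \<Longrightarrow> Q v' A' T'"
  shows "wp W S ranking Q v A T"
  unfolding ranking_def wp_Seq wp_Assign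
proof (intro conjI)
  let ?I = "\<lambda>v A T'. v rN = n \<and> v rM = m \<and> v rI \<le> n + 1 \<and> (\<forall>k. k \<noteq> 1 \<longrightarrow> A k = init k) \<and>
     v rS = rank x (v rI) \<and>
     (\<forall>c. A 1 c = (if c < v rI then rank x c else of_bool (c \<in> set x))) \<and> T' \<le> T + 20 + 30 * v rI"
  let ?v = "v(rS := ev (Lit 0) v A)"
  let ?v' = "?v(rI := ev (Lit 0) ?v A)"
  show "wp W S (While (Var rI [<] Var rN [+] Lit 1)
       (rT ::= Arr 1 (Var rI) ;; Put 1 (Var rI) (Var rS) ;; rS ::= Var rS [+] Var rT ;;
        rI ::= Var rI [+] Lit 1)) Q ?v' A (T + (ecost (Lit 0) + 1) + (ecost (Lit 0) + 1))"
  proof (rule wp_While[where I = ?I and M = "\<lambda>v A. n + 1 - v rI"], goal_cases)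
    case 1
    then show ?case using v A by (auto simp: rank_def)
  next
    case (2 v A T)
    then show ?case using W_lin by auto
  next
    case (3 v A T)
    then have "v rI = Suc n" by (auto split: if_splits)
    with 3 rank_all[OF letters] show ?case by (intro Q) auto
  next
    case (4 v A T)
    then have "v rI < n + 1" by (auto split: if_splits)
    moreover have "rank x (v rI) \<le> n"
      using rank_mono[of "v rI" "Suc n" x] rank_all[OF letters] s_le 4 by auto
    ultimately show ?case using 4 W_lin
      by (auto simp: rank_Suc less_Suc_eq)
  qed
qed (use W_lin in auto)

text \<open>The disjunction records which test ended the loop. If \<open>s = 1\<close> the powers
  never reach \<open>n\<close>, and the cap \<open>h\<close> stops it.\<close>

lemma wp_window_length:
  assumes v: "v rN = n" "v rM = m" "v rS = s"
    and Q: "\<And>v' T' l. v' rN = n \<Longrightarrow> v' rM = m \<Longrightarrow> v' rS = s \<Longrightarrow> v' rH = h \<Longrightarrow> v' rL = l \<Longrightarrow>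
      v' rB = s ^ (l - 1) \<Longrightarrow> 1 \<le> l \<Longrightarrow> l \<le> h \<Longrightarrow> s ^ (l - 1) < n \<Longrightarrow> l = h \<or> n \<le> s ^ l \<Longrightarrow>
      T' \<le> T + 50 * n + 100 \<Longrightarrow> Q v' A T'"
  shows "wp W S window_length Q v A T"
  unfolding window_length_def wp_Seq wp_Assign
proof (intro conjI)
  let ?I = "\<lambda>v A' T'. v rN = n \<and> v rM = m \<and> v rS = s \<and> v rH = h \<and> 1 \<le> v rL \<and> v rL \<le> h \<and>
     v rB = s ^ (v rL - 1) \<and> v rB < n \<and> A' = A \<and> T' \<le> T + 20 + 30 * v rL"
  let ?v1 = "v(rH := ev (Var rM [div] Lit 2) v A)"
  let ?v2 = "?v1(rL := ev (Lit 1) ?v1 A)"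
  let ?v3 = "?v2(rB := ev (Lit 1) ?v2 A)"
  show "wp W S (While ((Var rL [<] Var rH) [*] (Var rB [*] Var rS [<] Var rN))
       (rL ::= Var rL [+] Lit 1 ;; rB ::= Var rB [*] Var rS)) Q ?v3 A
       (T + (ecost (Var rM [div] Lit 2) + 1) + (ecost (Lit 1) + 1) + (ecost (Lit 1) + 1))"
  proof (rule wp_While[where I = ?I and M = "\<lambda>v A. h - v rL"], goal_cases)
    case 1
    then show ?case using v m2 m_less by auto
  next
    case (2 v A' T)
    then have "v rB \<le> S" by linarith
    from 2 W_prod[OF this, of s 0] s_le W_lin show ?case by auto
  next
    case (3 v A' T)
    then have "v rL = h \<or> n \<le> v rB * s" by (auto split: if_splits)
    moreover have "v rB * s = s ^ v rL" using 3 by (cases "v rL") auto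
    moreover have "v rL \<le> n" using 3 m_less by auto
    moreover have "A' = A" using 3 by simp
    ultimately show ?case using 3 by (simp only:) (intro Q[where l = "v rL"], auto)
  next
    case (4 v A' T)
    then have "v rL < h" "v rB * s < n" by (auto split: if_splits)
    moreover have "v rB * s = s ^ v rL" using 4 by (cases "v rL") auto
    ultimately show ?case using 4 m_less W_lin by auto
  qed
qed (use W_lin in auto)

end

section \<open>Window codes and links between positions of equal code\<close>

locale mapp_window = mapp +
  fixes l :: nat
  assumes l1: "1 \<le> l" and l_le: "l \<le> h" and base_less: "s ^ (l - 1) < n"
    and l_enough: "l = h \<or> n \<le> s ^ l"
begin

abbreviation "D \<equiv> code x l"
text \<open>The number of full windows. Later positions have codes padded with zeros and are left
  out of the lists.\<close>

abbreviation "e \<equiv> n - l + 1"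

text \<open>The loop for \<open>l\<close> keeps \<open>s ^ (l - 1) < n\<close>, and one more digit
  multiplies by at most \<open>n\<close>. So the quotient of a code by \<open>n\<close> is again an
  index below \<open>n\<close>.\<close>

lemma D_less: "D i < n * n"
proof -
  have "D i < s ^ (l - 1) * s"
    using code_less[OF x_ne, of l i] l1 by (cases l) (auto simp: mult.commute)
  also have "\<dots> \<le> n * n" using base_less s_le by (intro mult_le_mono) auto
  finally show ?thesis .
qed

lemma D_div_less: "D i div n < n"
  using D_less[of i] by (simp add: less_mult_imp_div_less)

lemma l_less: "l < n"
  using l_le m_less by linarith

definition frame :: "vars \<Rightarrow> bool" where
  "frame v \<longleftrightarrow> v rN = n \<and> v rM = m \<and> v rH = h \<and> v rL = l"

lemma wp_coding:
  assumes v: "frame v" "v rS = s" "v rB = s ^ (l - 1)"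
    and A: "\<forall>k. k \<noteq> 1 \<longrightarrow> A k = init k" "\<forall>c \<le> n. A 1 c = rank x c"
    and Q: "\<And>v' A' T'. frame v' \<Longrightarrow> \<forall>i. A' 0 i = 0 \<Longrightarrow> \<forall>i < S. A' 2 i = digit x i \<Longrightarrow>
      \<forall>i. 1 \<le> i \<longrightarrow> i \<le> n \<longrightarrow> A' 3 i = D i \<Longrightarrow> \<forall>k \<ge> 4. \<forall>i. A' k i = 0 \<Longrightarrow>
      T' \<le> T + 100 * n + 100 \<Longrightarrow> Q v' A' T'"
  shows "wp W S coding Q v A T"
  unfolding coding_def wp_Seq wp_Assign
proof (intro conjI)
  let ?I = "\<lambda>v A T'. frame v \<and> v rS = s \<and> v rB = s ^ (l - 1) \<and> v rI \<le> n \<and>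
     v rC = D (v rI + 1) \<and> (\<forall>i. A 0 i = (if i < v rI then x ! i else 0)) \<and>
     (\<forall>c \<le> n. A 1 c = rank x c) \<and> (\<forall>i. A 2 i = (if v rI < i then digit x i else 0)) \<and>
     (\<forall>i. v rI < i \<longrightarrow> i \<le> n \<longrightarrow> A 3 i = D i) \<and> (\<forall>k \<ge> 4. \<forall>i. A k i = 0) \<and>
     T' \<le> T + 20 + 80 * (n - v rI)"
  let ?v1 = "v(rI := ev (Var rN) v A)"
  let ?v2 = "?v1(rC := ev (Lit 0) ?v1 A)"
  show "wp W S (While (Var rI)
       (rT ::= Arr 1 (Arr 0 (Var rI [-] Lit 1)) ;;
        rC ::= Var rC [div] Var rS [+] Var rT [*] Var rB ;;
        Put 2 (Var rI) (Var rT) ;; Put 3 (Var rI) (Var rC) ;; Put 0 (Var rI [-] Lit 1) (Lit 0) ;;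
        rI ::= Var rI [-] Lit 1)) Q ?v2 A (T + (ecost (Var rN) + 1) + (ecost (Lit 0) + 1))"
  proof (rule wp_While[where I = ?I and M = "\<lambda>v A. v rI"], goal_cases)
    case 1
    \<comment> \<open>The scan starts past the end, where all digits and hence the code are
      0.\<close>
    then show ?case using v A code_beyond[of x "Suc n"]
      by (auto simp: init_def frame_def digit_def)
  next
    case (2 v A T)
    then show ?case by auto
  next
    case (3 v A T)
    then have "v rI = 0" by auto
    moreover have "digit x 0 = 0" by (simp add: digit_def)
    ultimately show ?case using 3 by (intro Q) (auto intro!: gr0I)
  next
    case (4 v A T)
    define i where "i = v rI"
    have i: "1 \<le> i" "i \<le> n" "v rI = i" using 4 by (auto simp: i_def)
    have d: "A (Suc 0) (A 0 (i - Suc 0)) = digit x i" "A 0 (i - Suc 0) \<le> n"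
      using 4 i letter_le[of "i - 1"] by (auto simp: digit_def)
    have c: "D i = D (Suc i) div s + digit x i * s ^ (l - Suc 0)"
      using code_rec[OF x_ne l1, of i] by simp
    have "digit x i * s ^ (l - Suc 0) < W"
      using W_prod[of "digit x i" "s ^ (l - 1)" 0] digit_less[OF x_ne, of i] s_le base_less by simp
    moreover have "D i < W" using D_less[of i] W_prod[of n n 0] by simp
    ultimately show ?case
      using 4 i d c W_lin by (auto simp: frame_def Suc_diff_le)
  qed
qed (use W_lin v l_less in \<open>auto simp: frame_def\<close>)

lemma wp_buckets:
  assumes v: "frame v"
    and A: "\<forall>i. 1 \<le> i \<longrightarrow> i \<le> n \<longrightarrow> A 3 i = D i" "\<forall>k \<ge> 4. \<forall>i. A k i = 0"
    and Q: "\<And>v' A' T'. frame v' \<Longrightarrow> v' rE = e \<Longrightarrow> \<forall>k. k \<noteq> 4 \<longrightarrow> k \<noteq> 5 \<longrightarrow> A' k = A k \<Longrightarrow>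
      \<forall>u. linked (A' 5) (A' 4 u) (rev (filter (\<lambda>i. D i div n = u) [1..<e + 1])) \<Longrightarrow>
      T' \<le> T + 50 * n + 100 \<Longrightarrow> Q v' A' T'"
  shows "wp W S buckets Q v A T"
  unfolding buckets_def wp_Seq wp_Assign
proof (intro conjI)
  let ?I = "\<lambda>v A' T'. frame v \<and> v rE = e \<and> 1 \<le> v rI \<and> v rI \<le> e + 1 \<and>
     (\<forall>k. k \<noteq> 4 \<longrightarrow> k \<noteq> 5 \<longrightarrow> A' k = A k) \<and>
     (\<forall>u. linked (A' 5) (A' 4 u) (rev (filter (\<lambda>i. D i div n = u) [1..<v rI]))) \<and>
     T' \<le> T + 20 + 40 * v rI"
  let ?v1 = "v(rE := ev (Var rN [-] Var rL [+] Lit 1) v A)"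
  let ?v2 = "?v1(rI := ev (Lit 1) ?v1 A)"
  show "wp W S (While (Var rI [<] Var rE [+] Lit 1)
       (rT ::= Arr 3 (Var rI) [div] Var rN ;; Put 5 (Var rI) (Arr 4 (Var rT)) ;;
        Put 4 (Var rT) (Var rI) ;; rI ::= Var rI [+] Lit 1)) Q ?v2 A
      (T + (ecost (Var rN [-] Var rL [+] Lit 1) + 1) + (ecost (Lit 1) + 1))"
  proof (rule wp_While[where I = ?I and M = "\<lambda>v A. e + 1 - v rI"], goal_cases)
    case 1
    then show ?case using v A by (auto simp: frame_def)
  next
    case (2 v A T)
    then show ?case using W_lin by auto
  next
    case (3 v A T)
    then have "v rI = e + 1" by (auto split: if_splits)
    with 3 l1 l_less show ?case by (intro Q) auto
  next
    case (4 v A' T)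
    then have "v rI \<le> e" by (auto split: if_splits)
    then have i: "v rI \<le> n" "1 \<le> v rI" using l1 l_less 4 by auto
    then have "A' 3 (v rI) = D (v rI)" using 4 A by simp
    moreover have "linked ((A' 5)(v rI := z)) (A' 4 u) (rev (filter (\<lambda>i. D i div n = u) [1..<v rI]))"
      for u z using 4 by (subst linked_upd) auto
    ultimately show ?case using 4 i W_lin D_div_less[of "v rI"] \<open>v rI \<le> e\<close>
      by (auto simp: frame_def)
  qed
qed (use W_lin v l_less in \<open>auto simp: frame_def\<close>)

text \<open>\<open>P\<close> marks the processed positions. The order of \<open>R\<close> and the
  latest positions kept in array 6 are what \<open>linked_first\<close> asks for.\<close>

definition linked_upto :: "(nat \<Rightarrow> bool) \<Rightarrow> arrays \<Rightarrow> nat list \<Rightarrow> bool" where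
  "linked_upto P A R \<longleftrightarrow> distinct R \<and> set R = {k \<in> {1..e}. P k} \<and> same_key_links D (A 7) R \<and>
     sorted_wrt (\<lambda>a b. D b div n \<le> D a div n) R \<and>
     (\<forall>c < n. A 6 c = first (filter (\<lambda>k. D k mod n = c) R))"

lemma linked_upto_cong:
  assumes "\<And>k. 1 \<le> k \<Longrightarrow> k \<le> e \<Longrightarrow> P k \<longleftrightarrow> P' k"
  shows "linked_upto P A R \<longleftrightarrow> linked_upto P' A R"
proof -
  have "{k \<in> {1..e}. P k} = {k \<in> {1..e}. P' k}" using assms by auto
  then show ?thesis unfolding linked_upto_def by (rule arg_cong)
qed

lemma first_in: "first L \<noteq> 0 \<Longrightarrow> first L \<in> set L"
  by (cases L) (auto simp: first_def)

text \<open>Time is charged to the growth of the list of processed positions. Over all buckets the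
  lengths telescope to at most \<open>n\<close>, although a single bucket may be large.\<close>

lemma wp_link_bucket:
  assumes v: "frame v" "v rE = e" "v rU = u"
    and A: "\<forall>i. 1 \<le> i \<longrightarrow> i \<le> n \<longrightarrow> A 3 i = D i"
    and R: "linked_upto (\<lambda>k. D k div n < u) A R"
    and L: "linked (A 5) (v rJ) L" "distinct L" "set L = {k \<in> {1..e}. D k div n = u}"
    and Q: "\<And>v' A' T' R'. frame v' \<Longrightarrow> v' rE = e \<Longrightarrow> v' rU = u \<Longrightarrow>
      \<forall>k. k \<noteq> 6 \<longrightarrow> k \<noteq> 7 \<longrightarrow> A' k = A k \<Longrightarrow>
      linked_upto (\<lambda>k. D k div n < u + 1) A' R' \<Longrightarrow>
      T' + 50 * length R \<le> T + 10 + 50 * length R' \<Longrightarrow> Q v' A' T'"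
  shows "wp W S link_bucket Q v A T"
proof -
  let ?I = "\<lambda>L' v A' T'. frame v \<and> v rE = e \<and> v rU = u \<and> (\<forall>k. k \<noteq> 6 \<longrightarrow> k \<noteq> 7 \<longrightarrow> A' k = A k) \<and>
     linked (A 5) (v rJ) L' \<and> distinct L' \<and> set L' \<subseteq> {k \<in> {1..e}. D k div n = u} \<and>
     (\<exists>R'. linked_upto (\<lambda>k. D k div n < u + 1 \<and> k \<notin> set L') A' R' \<and>
       T' + 50 * length R \<le> T + 50 * length R')"
  show ?thesis
    unfolding link_bucket_def
  proof (rule wp_While_list[where I = ?I and L = L], goal_cases)
    case 1
    have "linked_upto (\<lambda>k. D k div n < u + 1 \<and> k \<notin> set L) A R"
      using R by (subst linked_upto_cong[where P' = "\<lambda>k. D k div n < u"]) (simp_all add: L(3) less_Suc_eq, auto)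
    with v L show ?case by auto
  next
    case (2 L v A T)
    then show ?case by auto
  next
    case (3 v A' T)
    then show ?case by (auto intro!: Q)
  next
    case (4 a L' v A' T')
    then obtain R' where R': "linked_upto (\<lambda>k. D k div n < u + 1 \<and> k \<notin> set (a # L')) A' R'"
      and T': "T' + 50 * length R \<le> T + 50 * length R'" by auto
    define c where "c = first (filter (\<lambda>k. D k mod n = D a mod n) R')"
    have a: "v rJ = a" "1 \<le> a" "a \<le> e" "D a div n = u" "a \<notin> set L'" "linked (A 5) (A 5 a) L'"
      using 4 by auto
    have en: "e \<le> n" using l1 l_less by linarith
    have A3: "A' 3 k = D k" if "1 \<le> k" "k \<le> e" for k
      using 4 A that en by simp
    have A5: "A' 5 = A 5" using 4 by simp
    have A6: "A' 6 (D a mod n) = c"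
      using R' x_ne by (auto simp: linked_upto_def c_def)
    have setR: "set R' = {k \<in> {1..e}. D k div n < u + 1 \<and> k \<notin> set (a # L')}"
      using R' by (simp add: linked_upto_def)
    have c: "c = 0 \<or> c \<in> set R'" using first_in[of "filter (\<lambda>k. D k mod n = D a mod n) R'"]
      by (auto simp: c_def)
    then have c_le: "c \<le> n" using en by (auto simp: setR)
    \<comment> \<open>For \<open>c = 0\<close> nothing is known about cell 0 of array 3, but both
      products are 0.\<close>
    have link: "c * of_bool (A' 3 c = A' 3 a) = c * of_bool (D c = D a)"
      using c A3[of c] A3[of a] a by (auto simp: setR)
    have l: "linked (A' 7) (c * of_bool (D c = D a)) (filter (\<lambda>k. D k = D a) R')"
      using R' a setR by (intro linked_first[where n = n]) (auto simp: linked_upto_def c_def)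
    have "a \<notin> set R'" by (simp add: setR)
    let ?A = "A'(7 := (A' 7)(a := c * of_bool (A' 3 c = A' 3 a)), 6 := (A' 6)(D a mod n := a))"
    have "linked_upto (\<lambda>k. D k div n < u + 1 \<and> k \<notin> set L') ?A (a # R')"
      unfolding linked_upto_def
    proof (intro conjI)
      show "distinct (a # R')" using R' \<open>a \<notin> set R'\<close> by (simp add: linked_upto_def)
      show "set (a # R') = {k \<in> {1..e}. D k div n < u + 1 \<and> k \<notin> set L'}"
        using a by (auto simp: setR)
      show "same_key_links D (?A 7) (a # R')"
        using R' l \<open>a \<notin> set R'\<close> by (simp add: link linked_upd same_key_links_upd linked_upto_def)
      show "sorted_wrt (\<lambda>a b. D b div n \<le> D a div n) (a # R')"
        using R' a by (auto simp: linked_upto_def setR)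
      show "\<forall>c<n. ?A 6 c = first (filter (\<lambda>k. D k mod n = c) (a # R'))"
        using R' by (auto simp: linked_upto_def first_def)
    qed
    moreover have "c * of_bool (A' 3 c = A' 3 a) < W" using c_le W_lin by auto
    moreover have "D a mod n < n" using x_ne by simp
    then have "D a mod n < S" by linarith
    ultimately show ?case
      using 4(1) a en c_le W_lin T' A3[of a] A6 A5
      by (auto simp: frame_def intro!: exI[of _ "a # R'"])
  qed
qed

lemma wp_linking:
  assumes v: "frame v" "v rE = e"
    and A: "\<forall>i. 1 \<le> i \<longrightarrow> i \<le> n \<longrightarrow> A 3 i = D i" "A 6 = (\<lambda>_. 0)"
    and L: "\<forall>u. linked (A 5) (A 4 u) (rev (filter (\<lambda>i. D i div n = u) [1..<e + 1]))"
    and Q: "\<And>v' A' T' R. frame v' \<Longrightarrow> v' rE = e \<Longrightarrow>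
      \<forall>k. k \<noteq> 6 \<longrightarrow> k \<noteq> 7 \<longrightarrow> A' k = A k \<Longrightarrow> same_key_links D (A' 7) R \<Longrightarrow> distinct R \<Longrightarrow>
      set R = {1..e} \<Longrightarrow> T' \<le> T + 100 * n + 100 \<Longrightarrow> Q v' A' T'"
  shows "wp W S linking Q v A T"
  unfolding linking_def wp_Seq wp_Assign
proof (intro conjI)
  let ?I = "\<lambda>v A' T'. frame v \<and> v rE = e \<and> v rU \<le> n \<and> (\<forall>k. k \<noteq> 6 \<longrightarrow> k \<noteq> 7 \<longrightarrow> A' k = A k) \<and>
     (\<exists>R. linked_upto (\<lambda>k. D k div n < v rU) A' R \<and> T' \<le> T + 20 + 40 * v rU + 50 * length R)"
  let ?v = "v(rU := ev (Lit 0) v A)"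
  show "wp W S (While (Var rU [<] Var rN)
       (rJ ::= Arr 4 (Var rU) ;; link_bucket ;; rU ::= Var rU [+] Lit 1)) Q ?v A
      (T + (ecost (Lit 0) + 1))"
  proof (rule wp_While[where I = ?I and M = "\<lambda>v A. n - v rU"], goal_cases)
    case 1
    have "linked_upto (\<lambda>k. D k div n < 0) A []" using A by (simp add: linked_upto_def first_def)
    with v show ?case by (auto simp: frame_def intro!: exI[of _ "[]"])
  next
    case (2 v A T)
    then show ?case using W_lin by auto
  next
    case (3 v A' T')
    then obtain R where R: "linked_upto (\<lambda>k. D k div n < v rU) A' R"
      and T': "T' \<le> T + 20 + 40 * v rU + 50 * length R" by auto
    have "v rU = n" using 3 by (auto simp: frame_def split: if_splits)
    with R D_div_less have set: "set R = {1..e}" and "distinct R" by (auto simp: linked_upto_def)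
    then have "length R \<le> n" using l1 l_less distinct_card[of R] by simp
    with R 3 set T' \<open>distinct R\<close> \<open>v rU = n\<close> show ?case
      by (intro Q[of v A' R]) (auto simp: linked_upto_def)
  next
    case (4 v A' T')
    then obtain R where R: "linked_upto (\<lambda>k. D k div n < v rU) A' R"
      and T': "T' \<le> T + 20 + 40 * v rU + 50 * length R" by auto
    have u: "v rU < n" using 4 by (auto simp: frame_def split: if_splits)
    let ?L = "rev (filter (\<lambda>i. D i div n = v rU) [1..<e + 1])"
    let ?v = "v(rJ := A' 4 (v rU))"
    have "wp W S link_bucket (wp W S (rU ::= Var rU [+] Lit 1)
        (\<lambda>v' A'' T''. ?I v' A'' T'' \<and> n - v' rU < n - v rU)) ?v A' T0" if "T0 \<le> T' + 12" for T0
    proof (rule wp_link_bucket[where L = ?L and R = R and u = "v rU"], goal_cases)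
      case 1
      then show ?case using 4 by (simp add: frame_def)
    next
      case 4
      have "A' 3 = A 3" using \<open>frame v \<and> _\<close> by simp
      then show ?case using A by simp
    next
      case 5
      show ?case using R .
    next
      case 6
      have "A' 5 = A 5" "A' 4 = A 4" using \<open>frame v \<and> _\<close> by simp_all
      then show ?case using L by simp
    next
      case 8
      show ?case by (auto simp del: upt_Suc)
    next
      case (9 v'' A'' T'' R'')
      from \<open>frame v \<and> _\<close> 9(4) have *: "\<forall>k. k \<noteq> 6 \<longrightarrow> k \<noteq> 7 \<longrightarrow> A'' k = A k" by simp
      have "T'' + 50 * length R \<le> T0 + 10 + 50 * length R''" by (rule 9(6))
      moreover have "T' \<le> T + 20 + 40 * v rU + 50 * length R" by (rule T')
      moreover have "T0 \<le> T' + 12" by (rule that)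
      ultimately have "T'' + 9 \<le> T + 20 + 40 * (v rU + 1) + 50 * length R''" by simp
      then show ?case using u W_lin 9(1-3,5) *
        by (auto simp: frame_def intro!: exI[of _ R''])
    qed (use 4 in auto)
    then show ?case using u W_lin by (auto simp: add.assoc)
  qed
qed (use W_lin in auto)

definition agree :: "nat \<Rightarrow> nat \<Rightarrow> nat \<Rightarrow> bool" where
  "agree j k L \<longleftrightarrow> (\<forall>t<L. digit x (j + t) = digit x (k + t))"

lemma agree_mono: "agree j k L \<Longrightarrow> L' \<le> L \<Longrightarrow> agree j k L'"
  by (auto simp: agree_def)

lemma D_eq_iff: "D j = D k \<longleftrightarrow> agree j k l"
  using code_eq_iff[OF x_ne] by (simp add: agree_def)

end

section \<open>One pass: verification of the linked pairs and its cost\<close>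

locale mapp_pass = mapp_window +
  fixes off len r rl :: nat
  assumes off_len: "off + len \<le> m" and r_rl: "r + rl \<le> m" and l_len: "l \<le> len"
begin

text \<open>Equivalent to \<open>j - off - 1\<close> being one of the starts \<open>0..n - m\<close>
  of a factor, but for the requirement \<open>off < j\<close>, which excludes truncated
  subtraction.\<close>

definition in_range :: "nat \<Rightarrow> bool" where
  "in_range j \<longleftrightarrow> off < j \<and> j < off + (n - m + 2)"

definition differ :: "nat \<Rightarrow> nat \<Rightarrow> nat \<Rightarrow> bool" where
  "differ j k t \<longleftrightarrow> digit x (j - off + r + t) \<noteq> digit x (k - off + r + t)"

definition hit :: "nat \<Rightarrow> nat \<Rightarrow> bool" where
  "hit j k \<longleftrightarrow> in_range j \<and> in_range k \<and> agree j k len \<and> (\<Sum>t<rl. of_bool (differ j k t)) = (1::nat)"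

text \<open>One unit for the visit, one per successful extension step, and \<open>rl\<close> for the
  mismatches. Extension steps appear as indicators of agreement so that means can be taken term by
  term.\<close>

definition pair_cost :: "nat \<Rightarrow> nat \<Rightarrow> nat" where
  "pair_cost j k = 1 + (\<Sum>L\<in>{l<..len}. of_bool (in_range j \<and> in_range k \<and> agree j k L)) +
     rl * of_bool (in_range j \<and> in_range k \<and> agree j k len)"

text \<open>What one visited pair adds to counter \<open>i\<close>. Pairs are visited unordered, so
  both ends are served at once.\<close>

definition inc :: "nat \<Rightarrow> nat \<Rightarrow> nat \<Rightarrow> nat" where
  "inc i j k = of_bool (hit j k) * (of_bool (j = i + off + 1) + of_bool (k = i + off + 1))"

definition pframe :: "vars \<Rightarrow> bool" where
  "pframe v \<longleftrightarrow> frame v \<and> v rE = e \<and> v rO = off \<and> v rLen = len \<and> v rR = r \<and> v rRl = rl"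

lemma wp_extend:
  assumes v: "pframe v" "v rJ = j" "v rK = k"
    and jk: "in_range j" "in_range k" "D j = D k"
    and A: "\<forall>i < S. A 2 i = digit x i"
    and Q: "\<And>v' T' t. \<forall>q. q \<noteq> rT \<longrightarrow> v' q = v q \<Longrightarrow> v' rT = t \<Longrightarrow> l \<le> t \<Longrightarrow> t \<le> len \<Longrightarrow>
      agree j k t \<Longrightarrow> t < len \<Longrightarrow> \<not> agree j k len \<Longrightarrow> T' \<le> T + 50 + 40 * (t - l) \<Longrightarrow> Q v' A T'"
    and Q': "\<And>v' T'. \<forall>q. q \<noteq> rT \<longrightarrow> v' q = v q \<Longrightarrow> v' rT = len \<Longrightarrow>
      agree j k len \<Longrightarrow> T' \<le> T + 50 + 40 * (len - l) \<Longrightarrow> Q v' A T'"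
  shows "wp W S extend Q v A T"
  unfolding extend_def wp_Seq wp_Assign
proof (intro conjI)
  let ?I = "\<lambda>v' A' T'. (\<forall>q. q \<noteq> rT \<longrightarrow> v' q = v q) \<and> A' = A \<and> l \<le> v' rT \<and> v' rT \<le> len \<and>
    agree j k (v' rT) \<and> T' + 40 * l \<le> T + 10 + 40 * v' rT"
  let ?v = "v(rT := ev (Var rL) v A)"
  \<comment> \<open>The loop test always evaluates both factors, so digits at offset
    \<open>len\<close> are read as well, up to cell \<open>n + 1\<close>. Hence arrays of length
    \<open>n + 2\<close>.\<close>
  have bd: "j + len < S" "k + len < S" using jk off_len m_less by (auto simp: in_range_def)
  show "wp W S (While ((Var rT [<] Var rLen) [*]
      (Arr 2 (Var rJ [+] Var rT) [=] Arr 2 (Var rK [+] Var rT)))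
       (rT ::= Var rT [+] Lit 1)) Q ?v A (T + (ecost (Var rL) + 1))"
  proof (rule wp_While[where I = ?I and M = "\<lambda>v A. len - v rT"], goal_cases)
    case 1
    then show ?case using v jk l_len D_eq_iff by (auto simp: frame_def pframe_def)
  next
    case (2 v' A' T')
    then show ?case using v bd W_lin by (auto simp: pframe_def)
  next
    case (3 v' A' T')
    then have AA: "A' = A" by simp
    have bd': "j + v' rT < S" "k + v' rT < S" using 3 bd by auto
    show ?case
    proof (cases "v' rT = len")
      case True
      with 3 l_len show ?thesis unfolding AA by (intro Q') auto
    next
      case False
      with 3 have "v' rT < len" by auto
      moreover from this 3 v A bd' have "digit x (j + v' rT) \<noteq> digit x (k + v' rT)"
        by (auto simp: pframe_def split: if_splits)
      ultimately have "\<not> agree j k len" by (auto simp: agree_def)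
      with 3 \<open>v' rT < len\<close> show ?thesis unfolding AA by (intro Q[where t = "v' rT"]) auto
    qed
  next
    case (4 v' A' T')
    then have "v' rT < len" using v by (auto simp: pframe_def split: if_splits)
    moreover from this 4 v A bd have "digit x (j + v' rT) = digit x (k + v' rT)"
      by (auto simp: pframe_def split: if_splits)
    moreover have "agree j k (Suc (v' rT))"
      using 4 calculation by (auto simp: agree_def less_Suc_eq)
    ultimately show ?case using 4 v bd W_lin by auto
  qed
qed (use W_lin in auto)

lemma wp_mismatches:
  assumes v: "pframe v" "v rJ = j" "v rK = k"
    and jk: "in_range j" "in_range k"
    and A: "\<forall>i < S. A 2 i = digit x i"
    and Q: "\<And>v' T'. \<forall>q. q \<noteq> rT \<longrightarrow> q \<noteq> rQ \<longrightarrow> v' q = v q \<Longrightarrow>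
      v' rQ = (\<Sum>t<rl. of_bool (differ j k t)) \<Longrightarrow> T' \<le> T + 20 + 50 * rl \<Longrightarrow> Q v' A T'"
  shows "wp W S mismatches Q v A T"
  unfolding mismatches_def wp_Seq wp_Assign
proof (intro conjI)
  let ?I = "\<lambda>v' A' T'. (\<forall>q. q \<noteq> rT \<longrightarrow> q \<noteq> rQ \<longrightarrow> v' q = v q) \<and> A' = A \<and> v' rT \<le> rl \<and>
    v' rQ \<le> v' rT \<and> v' rQ = (\<Sum>t<v' rT. of_bool (differ j k t)) \<and> T' \<le> T + 10 + 50 * v' rT"
  let ?v1 = "v(rQ := ev (Lit 0) v A)"
  let ?v2 = "?v1(rT := ev (Lit 0) ?v1 A)"
  obtain a b where ab: "j = off + a" "k = off + b"
    using jk unfolding in_range_def by (meson le_iff_add less_imp_le)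
  then have bd: "a + r + rl \<le> n + 1" "b + r + rl \<le> n + 1" "j < S" "k < S"
    using jk r_rl m_less off_len l1 l_len by (auto simp: in_range_def)
  show "wp W S (While (Var rT [<] Var rRl)
       (rQ ::= Var rQ [+] (Lit 1 [-]
          (Arr 2 (Var rJ [-] Var rO [+] Var rR [+] Var rT) [=]
           Arr 2 (Var rK [-] Var rO [+] Var rR [+] Var rT))) ;;
        rT ::= Var rT [+] Lit 1)) Q ?v2 A (T + (ecost (Lit 0) + 1) + (ecost (Lit 0) + 1))"
  proof (rule wp_While[where I = ?I and M = "\<lambda>v A. rl - v rT"], goal_cases)
    case 1
    then show ?case by auto
  next
    case (2 v' A' T')
    then show ?case using W_lin by auto
  next
    case (3 v' A' T')
    then have AA: "A' = A" by simp
    have "v' rT = rl" using 3 v by (auto simp: pframe_def split: if_splits)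
    with 3 show ?case unfolding AA by (intro Q) auto
  next
    case (4 v' A' T')
    then have t: "v' rT < rl" using v by (auto simp: pframe_def split: if_splits)
    have bd': "a + r + v' rT \<le> n" "b + r + v' rT \<le> n" using bd t by linarith+
    then have dj: "A 2 (a + r + v' rT) = digit x (a + r + v' rT)"
      and dk: "A 2 (b + r + v' rT) = digit x (b + r + v' rT)"
      using A by auto
    have rn: "rl \<le> n" using r_rl m_less by linarith
    have regs: "v' rO = off" "v' rR = r" "v' rRl = rl" "v' rJ = off + a" "v' rK = off + b"
      using 4 v ab by (auto simp: pframe_def)
    have W': "off + a < W" "off + b < W" "a + r + v' rT < W" "b + r + v' rT < W" "a < W" "b < W"
      "a + r < W" "b + r < W" "Suc (v' rT) < W" "Suc (v' rQ) < W" "Suc 0 < W"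
      using ab bd bd' W_lin t 4 rn by auto
    show ?case using 4 t bd' W' by (simp add: regs differ_def dj dk ab del: sum_of_bool_eq)
  qed
qed (use W_lin in auto)

text \<open>Agreement on \<open>t\<close> letters implies agreement on every shorter length, so each
  length above \<open>l\<close> and up to \<open>t\<close> contributes an indicator.\<close>

lemma extend_cost:
  assumes "in_range j" "in_range k" "agree j k t" "t \<le> len"
  shows "t - l + 1 \<le> pair_cost j k"
proof -
  have "t - l = (\<Sum>L\<in>{l<..t}. 1)" by simp
  also have "\<dots> \<le> (\<Sum>L\<in>{l<..t}. of_bool (in_range j \<and> in_range k \<and> agree j k L))"
    using assms by (intro sum_mono) (auto dest: agree_mono)
  also have "\<dots> \<le> (\<Sum>L\<in>{l<..len}. of_bool (in_range j \<and> in_range k \<and> agree j k L))"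
    using assms by (intro sum_mono2) auto
  finally show ?thesis by (simp add: pair_cost_def)
qed

lemma wp_verify:
  assumes v: "pframe v" "v rJ = j" "v rK = k" "j \<noteq> k" "D j = D k" "j \<le> n" "k \<le> n"
    and A: "\<forall>i < S. A 2 i = digit x i" "\<forall>i. A 0 i \<le> 20 * (S * S)"
    and Q: "\<And>v' A' T'. \<forall>q. q \<noteq> rT \<longrightarrow> q \<noteq> rQ \<longrightarrow> v' q = v q \<Longrightarrow>
      \<forall>k. k \<noteq> 0 \<longrightarrow> A' k = A k \<Longrightarrow> \<forall>i. A' 0 i = A 0 i + inc i j k \<Longrightarrow>
      T' \<le> T + 300 * pair_cost j k \<Longrightarrow> Q v' A' T'"
  shows "wp W S verify Q v A T"
proof -
  have regs: "v rO = off" "v rN = n" "v rM = m" "v rRl = rl" "v rLen = len"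
    using v by (auto simp: pframe_def frame_def)
  have offn: "off \<le> n" "m \<le> n" using off_len m_less by auto
  have pc1: "1 \<le> pair_cost j k" by (simp add: pair_cost_def)
  have small: "a < W" if "a \<le> 25 * (S * S)" for a using that W by simp
  show ?thesis
  proof (cases "in_range j \<and> in_range k")
    case False
    then have "\<not> hit j k" by (auto simp: hit_def)
    then have "Q v A T0" if "T0 \<le> T + 300 * pair_cost j k" for T0
      using that by (intro Q) (auto simp: inc_def)
    with False regs offn v W_lin pc1 show ?thesis
      unfolding verify_def by (auto simp: in_range_def)
  next
    case True
    have *: "wp W S (extend ;; If (Var rT [<] Var rLen) Skip
          (mismatches ;; If (Var rQ [=] Lit 1) (bump rJ ;; bump rK) Skip)) Q v A T0"
      if T0: "T0 \<le> T + 100" for T0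
      unfolding wp_Seq
    proof (rule wp_extend[OF v(1-3)], goal_cases)
      case (5 v' T' t)
      from extend_cost[of j k t] True 5 have "t - l + 1 \<le> pair_cost j k" by simp
      then have "T' + 5 \<le> T + 300 * pair_cost j k" using 5 T0 by linarith
      moreover have "\<not> hit j k" using 5 by (auto simp: hit_def)
      ultimately have "Q v' A T0" if "T0 \<le> T' + 5" for T0
        using that 5 by (intro Q) (auto simp: inc_def)
      with 5 regs W_lin show ?case by auto
    next
      case (6 v' T')
      have pc: "pair_cost j k \<ge> 1 + (len - l) + rl"
      proof -
        have "(\<Sum>L\<in>{l<..len}. of_bool (in_range j \<and> in_range k \<and> agree j k L)) =
            (\<Sum>L\<in>{l<..len}. 1 :: nat)"
          using 6 True by (intro sum.cong) (auto dest: agree_mono)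
        with 6 True show ?thesis by (simp add: pair_cost_def)
      qed
      have "wp W S mismatches (wp W S (If (Var rQ [=] Lit 1) (bump rJ ;; bump rK) Skip) Q) v' A T1"
        if T1: "T1 \<le> T' + 10" for T1
      proof (rule wp_mismatches[of v' j k], goal_cases)
        case 1
        then show ?case using v 6 by (auto simp: pframe_def frame_def)
      next
        case (7 v'' T'')
        have q: "v'' rQ = 1 \<longleftrightarrow> hit j k" using 7 6 True by (auto simp: hit_def)
        have v'': "v'' rJ = j" "v'' rK = k" "v'' rO = off" using 7 6 v regs by auto
        have eq: "\<forall>q. q \<noteq> rT \<longrightarrow> q \<noteq> rQ \<longrightarrow> v'' q = v q" using 7 6 by auto
        have T'': "T'' + 100 \<le> T + 300 * pair_cost j k" using 7 6 T0 T1 pc by linarith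
        have jk: "off < j" "off < k" "j < S" "k < S" using True v by (auto simp: in_range_def)
        show ?case
        proof (cases "hit j k")
          case False
          then have "Q v'' A T2" if "T2 \<le> T'' + 100" for T2
            using that T'' eq by (intro Q) (auto simp: inc_def)
          with False q W_lin show ?thesis by auto
        next
          case True
          obtain a b where ab: "j = off + 1 + a" "k = off + 1 + b"
            using jk by (metis Suc_eq_plus1 Suc_leI le_iff_add)
          let ?A1 = "A(0 := (A 0)(a := A 0 a + 1))"
          let ?A2 = "?A1(0 := (?A1 0)(b := ?A1 0 b + 1))"
          \<comment> \<open>The two ends are different positions, so the increments go to different
            counters.\<close>
          have ne: "a \<noteq> b" using ab v by auto
          have "?A2 0 i = A 0 i + inc i j k" for i
            using True ab ne by (auto simp: inc_def)
          then have Q2: "Q v'' ?A2 T2" if "T2 \<le> T'' + 100" for T2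
            using that T'' eq by (intro Q) auto
          have W': "Suc (A 0 i) < W" for i
            using A(2)[rule_format, of i] by (intro small) simp
          have "off + 1 + a < W" "off + 1 + b < W" "off < W" "a < S" "b < S" "Suc a < W" "Suc b < W" "Suc 0 < W"
            using jk ab W_lin by auto
          with Q2 True q ab v'' ne W' show ?thesis by (simp add: bump_def)
        qed
      qed (use v 6 True A in auto)
      with 6 regs W_lin show ?case by auto
    qed (use True v A in auto)
    show ?thesis
      using True regs offn v W_lin *
      unfolding verify_def by (auto simp: in_range_def)
  qed
qed

lemma inc_le: "inc i j k \<le> 2"
  by (simp add: inc_def)

lemma wp_walk:
  assumes v: "pframe v" "v rJ = j" "j \<le> n"
    and L: "linked (A 7) (v rK) L" "set L \<subseteq> {k \<in> {1..e}. k \<noteq> j \<and> D k = D j}"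
    and A: "\<forall>i < S. A 2 i = digit x i" "\<forall>i. A 0 i + 2 * length L \<le> 20 * (S * S)"
    and Q: "\<And>v' A' T'. \<forall>q. q \<noteq> rT \<longrightarrow> q \<noteq> rQ \<longrightarrow> q \<noteq> rK \<longrightarrow> v' q = v q \<Longrightarrow>
      \<forall>k. k \<noteq> 0 \<longrightarrow> A' k = A k \<Longrightarrow> \<forall>i. A' 0 i = A 0 i + (\<Sum>k\<leftarrow>L. inc i j k) \<Longrightarrow>
      T' \<le> T + 10 + 320 * (\<Sum>k\<leftarrow>L. pair_cost j k) \<Longrightarrow> Q v' A' T'"
  shows "wp W S walk Q v A T"
proof -
  let ?I = "\<lambda>L' v' A' T'. (\<forall>q. q \<noteq> rT \<longrightarrow> q \<noteq> rQ \<longrightarrow> q \<noteq> rK \<longrightarrow> v' q = v q) \<and>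
    (\<forall>k. k \<noteq> 0 \<longrightarrow> A' k = A k) \<and> linked (A 7) (v' rK) L' \<and>
    (\<exists>L1. L = L1 @ L' \<and> (\<forall>i. A' 0 i = A 0 i + (\<Sum>k\<leftarrow>L1. inc i j k)) \<and>
      T' \<le> T + 320 * (\<Sum>k\<leftarrow>L1. pair_cost j k))"
  show ?thesis
    unfolding walk_def
  proof (rule wp_While_list[where I = ?I and L = L], goal_cases)
    case 1
    with L show ?case by auto
  next
    case (2 L v A T)
    then show ?case by auto
  next
    case (3 v' A' T')
    then show ?case by (auto intro!: Q)
  next
    case (4 k L' v' A' T')
    then obtain L1 where L1: "L = L1 @ k # L'" "\<forall>i. A' 0 i = A 0 i + (\<Sum>k\<leftarrow>L1. inc i j k)"
      "T' \<le> T + 320 * (\<Sum>k\<leftarrow>L1. pair_cost j k)" by auto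
    have k: "v' rK = k" "k \<noteq> 0" "linked (A 7) (A 7 k) L'" using 4 by auto
    have kL: "1 \<le> k" "k \<le> e" "k \<noteq> j" "D k = D j" using L L1 by auto
    have kn: "k \<le> n" using kL l1 l_less by linarith
    have A': "A' 2 = A 2" "A' 7 = A 7" using 4 by simp_all
    have v'eq: "\<forall>q. q \<noteq> rT \<longrightarrow> q \<noteq> rQ \<longrightarrow> q \<noteq> rK \<longrightarrow> v' q = v q" using 4 by simp
    have inc1: "(\<Sum>k\<leftarrow>L1. inc i j k) \<le> 2 * length L1" for i
      by (induction L1) (use add_mono[OF inc_le] in auto)
    have "A' 0 i \<le> A 0 i + 2 * length L" for i
      using L1(2)[rule_format, of i] inc1[of i] L1(1) by simp
    then have A0: "\<forall>i. A' 0 i \<le> 20 * (S * S)" using A(2) order_trans by blast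
    have "wp W S verify (wp W S (rK ::= Arr 7 (Var rK)) (?I L')) v' A' T0" if "T0 \<le> T' + 5" for T0
    proof (rule wp_verify[of v' j k], goal_cases)
      case 1
      then show ?case using v v'eq by (simp add: pframe_def frame_def)
    next
      case (10 v'' A'' T'')
      have "A'' 7 = A 7" using 10(2) A' by simp
      moreover have "v'' rK = k" using 10(1) k by simp
      moreover have "T'' + 10 \<le> T + 320 * (\<Sum>k\<leftarrow>L1 @ [k]. pair_cost j k)"
        using 10(4) that L1 by (simp add: pair_cost_def)
      moreover have "\<forall>i. A'' 0 i = A 0 i + (\<Sum>k\<leftarrow>L1 @ [k]. inc i j k)"
        using 10(3) L1 by simp
      ultimately show ?case
        using 10(1,2) v'eq 4(1) k kn L1(1) W_lin by (simp del: sum_list_append)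
    qed (use v v'eq k kL kn A' A A0 in auto)
    with k show ?case by simp
  qed
qed

lemma wp_pairs:
  assumes v: "pframe v"
    and ch: "\<And>j. j \<in> {1..e} \<Longrightarrow> linked (A 7) (A 7 j) (ch j)"
      "\<And>j. j \<in> {1..e} \<Longrightarrow> distinct (ch j)"
      "\<And>j. j \<in> {1..e} \<Longrightarrow> set (ch j) \<subseteq> {k \<in> {1..e}. k \<noteq> j \<and> D k = D j}"
    and A: "\<forall>i < S. A 2 i = digit x i" "\<forall>i. A 0 i \<le> 4 * (S * S)"
    and Q: "\<And>v' A' T'. pframe v' \<Longrightarrow> \<forall>k. k \<noteq> 0 \<longrightarrow> A' k = A k \<Longrightarrow>
      \<forall>i. A' 0 i = A 0 i + (\<Sum>j\<in>{1..e}. \<Sum>k\<in>set (ch j). inc i j k) \<Longrightarrow>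
      T' \<le> T + 100 + 100 * n + 320 * (\<Sum>j\<in>{1..e}. \<Sum>k\<in>set (ch j). pair_cost j k) \<Longrightarrow> Q v' A' T'"
  shows "wp W S pairs Q v A T"
  unfolding pairs_def wp_Seq wp_Assign
proof (intro conjI)
  have en: "e \<le> n" using l1 l_less by linarith
  have len_ch: "length (ch j) \<le> n" if "j \<in> {1..e}" for j
  proof -
    have "length (ch j) = card (set (ch j))" using ch that by (simp add: distinct_card)
    also have "\<dots> \<le> card {1..e}" using ch(3)[OF that] by (intro card_mono) blast+
    finally show ?thesis using en by simp
  qed
  have lists: "(\<Sum>k\<leftarrow>ch j. f k) = (\<Sum>k\<in>set (ch j). f k)" if "j \<in> {1..e}" for j and f :: "nat \<Rightarrow> nat"
    using ch that by (simp add: sum_list_distinct_conv_sum_set)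
  let ?I = "\<lambda>v A' T'. pframe v \<and> 1 \<le> v rJ \<and> v rJ \<le> e + 1 \<and>
    (\<forall>k. k \<noteq> 0 \<longrightarrow> A' k = A k) \<and>
    (\<forall>i. A' 0 i = A 0 i + (\<Sum>j\<in>{1..<v rJ}. \<Sum>k\<in>set (ch j). inc i j k)) \<and>
    T' \<le> T + 10 + 40 * v rJ + 320 * (\<Sum>j\<in>{1..<v rJ}. \<Sum>k\<in>set (ch j). pair_cost j k)"
  let ?v = "v(rJ := ev (Lit 1) v A)"
  show "wp W S (While (Var rJ [<] Var rE [+] Lit 1)
       (rK ::= Arr 7 (Var rJ) ;; walk ;; rJ ::= Var rJ [+] Lit 1)) Q ?v A (T + (ecost (Lit 1) + 1))"
  proof (rule wp_While[where I = ?I and M = "\<lambda>v A. e + 1 - v rJ"], goal_cases)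
    case 1
    then show ?case using v by (auto simp: pframe_def frame_def)
  next
    case (2 v A T)
    then show ?case using W_lin en by (auto simp: pframe_def)
  next
    case (3 v' A' T')
    then have "v' rJ = e + 1" by (auto simp: pframe_def split: if_splits)
    moreover have "{1..<e + 1} = {1..e}" by auto
    ultimately show ?case using 3 en by (intro Q) auto
  next
    case (4 v' A' T')
    define j where "j = v' rJ"
    have j: "1 \<le> j" "j \<le> e" "v' rJ = j" using 4 by (auto simp: pframe_def j_def split: if_splits)
    then have je: "j \<in> {1..e}" by simp
    have ins: "{1..<j + 1} = insert j {1..<j}" using j by auto
    have A': "A' 2 = A 2" "A' 7 = A 7" using 4 by simp_all
    have A0: "A' 0 i = A 0 i + (\<Sum>j\<in>{1..<j}. \<Sum>k\<in>set (ch j). inc i j k)" for i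
      using 4 j by simp
    \<comment> \<open>A crude bound on the counters, 2 per visited pair and at most \<open>n\<close>
      pairs per position, to exclude overflow.\<close>
    have s1: "(\<Sum>j\<in>{1..<j}. \<Sum>k\<in>set (ch j). inc i j k) \<le> (\<Sum>j\<in>{1..<j}. 2 * n)" for i
    proof (rule sum_mono)
      fix j' assume "j' \<in> {1..<j}"
      then have "j' \<in> {1..e}" using j by auto
      have "(\<Sum>k\<in>set (ch j'). inc i j' k) \<le> of_nat (card (set (ch j'))) * 2"
        by (intro sum_bounded_above inc_le)
      also have "\<dots> \<le> n * 2" using len_ch[OF \<open>j' \<in> {1..e}\<close>] card_length[of "ch j'"] by simp
      finally show "(\<Sum>k\<in>set (ch j'). inc i j' k) \<le> 2 * n" by simp
    qed
    have s2: "(\<Sum>j\<in>{1..<j}. 2 * n) \<le> 2 * (S * S)"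
    proof -
      have "(\<Sum>j\<in>{1..<j}. 2 * n) = (j - 1) * (2 * n)" by simp
      also have "\<dots> \<le> S * (2 * S)" using j en by (intro mult_le_mono) auto
      finally show ?thesis by (simp only: mult.left_commute)
    qed
    have s3: "(\<Sum>j\<in>{1..<j}. \<Sum>k\<in>set (ch j). inc i j k) \<le> 2 * (S * S)" for i
      by (rule order_trans[OF s1 s2])
    have s4: "length (ch j) \<le> S * S" using len_ch[OF je] by simp
    have A0': "\<forall>i. A' 0 i + 2 * length (ch j) \<le> 20 * (S * S)"
      unfolding A0
    proof (intro allI)
      fix i
      have "a \<le> 4 * c \<Longrightarrow> b \<le> 2 * c \<Longrightarrow> d \<le> c \<Longrightarrow> a + b + 2 * d \<le> 20 * c" for a b c d :: nat
        by linarith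
      from this[OF A(2)[rule_format] s3 s4]
      show "A 0 i + (\<Sum>j\<in>{1..<j}. \<Sum>k\<in>set (ch j). inc i j k) + 2 * length (ch j) \<le> 20 * (S * S)" .
    qed
    let ?v = "v'(rK := A' 7 j)"
    have "wp W S walk (wp W S (rJ ::= Var rJ [+] Lit 1)
        (\<lambda>v'' A'' T''. ?I v'' A'' T'' \<and> e + 1 - v'' rJ < e + 1 - v' rJ)) ?v A' T0"
      if "T0 \<le> T' + 20" for T0
    proof (rule wp_walk[of ?v j A' "ch j"], goal_cases)
      case 1
      then show ?case using 4 by (simp add: pframe_def frame_def)
    next
      case 4
      then show ?case using ch(1)[OF je] A' by simp
    next
      case 5
      then show ?case by (rule ch(3)[OF je])
    next
      case 7
      then show ?case using A0' .
    next
      case (8 v'' A'' T'')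
      have "v'' rJ = j" using 8(1) j by simp
      moreover have "pframe v''"
        using 8(1) \<open>pframe v' \<and> _\<close> by (simp add: pframe_def frame_def)
      moreover have "\<forall>k. k \<noteq> 0 \<longrightarrow> A'' k = A k" using 8(2) \<open>pframe v' \<and> _\<close> by simp
      moreover have "\<forall>i. A'' 0 i = A 0 i + (\<Sum>j\<in>{1..<j+1}. \<Sum>k\<in>set (ch j). inc i j k)"
        using 8(3) A0 lists[OF je] by (simp only: ins) simp
      moreover have "T'' + 10 \<le> T + 10 + 40 * (j + 1) +
          320 * (\<Sum>j\<in>{1..<j+1}. \<Sum>k\<in>set (ch j). pair_cost j k)"
        using 8(4) that \<open>pframe v' \<and> _\<close> j lists[OF je, of "pair_cost j"] by (simp only: ins) simp
      ultimately show ?case using j en W_lin by (auto simp: pframe_def frame_def)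
    qed (use 4 A A' j en in auto)
    then show ?case using j en W_lin by simp
  qed
qed (use W_lin in auto)

end

section \<open>Counting pairs of factors\<close>

definition equal_windows :: "'a list \<Rightarrow> nat \<Rightarrow> nat \<Rightarrow> nat \<Rightarrow> bool" where
  "equal_windows x p q L \<longleftrightarrow> p + L \<le> length x \<and> q + L \<le> length x \<and> (\<forall>t<L. x ! (p + t) = x ! (q + t))"

text \<open>Bounds the cost of a pair in either pass by properties of the string alone. The term
  \<open>m\<close> is paid only if \<open>m div 2\<close> letters agree, since each half has at
  least that length.\<close>

definition work :: "'a list \<Rightarrow> nat \<Rightarrow> nat \<Rightarrow> nat \<Rightarrow> nat \<Rightarrow> nat" where
  "work x m l p q = (\<Sum>L\<in>{l..length x}. of_bool (equal_windows x p q L)) +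
     m * of_bool (equal_windows x p q (m div 2))"

definition total_work :: "'a list \<Rightarrow> nat \<Rightarrow> nat \<Rightarrow> nat" where
  "total_work x m l = (\<Sum>p<length x. \<Sum>q\<in>{..<length x} - {p}. work x m l p q)"

definition mism :: "nat list \<Rightarrow> nat \<Rightarrow> nat \<Rightarrow> nat \<Rightarrow> nat \<Rightarrow> nat" where
  "mism x i j a L = card {t. t < L \<and> x ! (i + a + t) \<noteq> x ! (j + a + t)}"

lemma mism_zero: "mism x i j a L = 0 \<longleftrightarrow> (\<forall>t<L. x ! (i + a + t) = x ! (j + a + t))"
  by (auto simp: mism_def)

lemma hamming_factor:
  assumes "h \<le> m" "1 \<le> m"
  shows "hamming_dist (factor x i (i + m - 1)) (factor x j (j + m - 1)) =
    mism x i j 0 h + mism x i j h (m - h)"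
proof -
  have f: "factor x i (i + m - 1) = map (\<lambda>p. x ! (i + p)) [0..<m]" for i
    using assms by (intro nth_equalityI) (auto simp: factor_def simp del: upt_Suc)
  have "{p. p < m \<and> x ! (i + p) \<noteq> x ! (j + p)} =
      {t. t < h \<and> x ! (i + 0 + t) \<noteq> x ! (j + 0 + t)} \<union>
      (+) h ` {t. t < m - h \<and> x ! (i + h + t) \<noteq> x ! (j + h + t)}" (is "?L = ?A \<union> _ ` ?B")
  proof (intro equalityI subsetI)
    fix p assume p: "p \<in> ?L"
    show "p \<in> ?A \<union> (+) h ` ?B"
    proof (cases "p < h")
      case False
      then have "p = h + (p - h)" by simp
      with p False show ?thesis
        by (intro UnI2 image_eqI[of _ _ "p - h"]) (auto simp: add.assoc)
    qed (use p in auto)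
  qed (use assms in \<open>auto simp: add.assoc\<close>)
  then have "card {p. p < m \<and> x ! (i + p) \<noteq> x ! (j + p)} = card ?A + card ((+) h ` ?B)"
    by (simp only:) (subst card_Un_disjoint, auto)
  also have "card ((+) h ` ?B) = card ?B" by (intro card_image) auto
  finally have *: "card {p. p < m \<and> x ! (i + p) \<noteq> x ! (j + p)} = card ?A + card ?B" .
  show ?thesis
    unfolding hamming_dist_def f mism_def *[symmetric] by (rule arg_cong[where f = card]) auto
qed

context mapp_pass
begin

lemma hit_sym: "hit j k \<longleftrightarrow> hit k j"
proof -
  have "differ j k = differ k j" "agree j k = agree k j"
    by (auto simp: differ_def agree_def fun_eq_iff)
  then show ?thesis by (auto simp: hit_def)
qed

lemma hit_iff:
  assumes "i \<le> n - m" "j \<le> n - m"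
  shows "hit (i + off + 1) (j + off + 1) \<longleftrightarrow> mism x i j off len = 0 \<and> mism x i j r rl = 1"
proof -
  have "agree (i + off + 1) (j + off + 1) len \<longleftrightarrow> mism x i j off len = 0"
    unfolding agree_def mism_zero
  proof (intro all_cong)
    fix t assume "t < len"
    then have "i + off + t < n" "j + off + t < n" using assms off_len m_less by linarith+
    then show "digit x (i + off + 1 + t) = digit x (j + off + 1 + t) \<longleftrightarrow>
        x ! (i + off + t) = x ! (j + off + t)"
      by (subst digit_eq_iff) auto
  qed
  moreover have "(\<Sum>t<rl. of_bool (differ (i + off + 1) (j + off + 1) t)) = mism x i j r rl"
  proof -
    have "differ (i + off + 1) (j + off + 1) t \<longleftrightarrow> x ! (i + r + t) \<noteq> x ! (j + r + t)"
      if "t < rl" for t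
    proof -
      have "i + r + t < n" "j + r + t < n" using that assms r_rl m_less by linarith+
      then have "digit x (i + 1 + r + t) = digit x (j + 1 + r + t) \<longleftrightarrow>
          x ! (i + r + t) = x ! (j + r + t)"
        by (subst digit_eq_iff) auto
      then show ?thesis by (simp add: differ_def)
    qed
    then have "{..<rl} \<inter> Collect (differ (i + off + 1) (j + off + 1)) =
        {t. t < rl \<and> x ! (i + r + t) \<noteq> x ! (j + r + t)}"
      by auto
    then show ?thesis by (simp add: mism_def)
  qed
  moreover have "in_range (i + off + 1)" "in_range (j + off + 1)"
    using assms by (auto simp: in_range_def)
  ultimately show ?thesis unfolding hit_def by presburger
qed

text \<open>Counter \<open>i\<close> is increased by the pairs that contain
  \<open>i + off + 1\<close>. Each hit with this position lies in its chain or has it in its own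
  chain, never both, so every hit counts once.\<close>

lemma sum_inc:
  assumes ch: "\<And>j. j \<in> {1..e} \<Longrightarrow> set (ch j) \<subseteq> {k \<in> {1..e}. k \<noteq> j \<and> D k = D j}"
    and once: "\<And>j k. j \<in> {1..e} \<Longrightarrow> k \<in> {1..e} \<Longrightarrow> j \<noteq> k \<Longrightarrow> D j = D k \<Longrightarrow>
      (k \<in> set (ch j)) \<noteq> (j \<in> set (ch k))"
    and i: "i \<le> n - m"
  shows "(\<Sum>j\<in>{1..e}. \<Sum>k\<in>set (ch j). inc i j k) =
    card {j \<in> {0..n - m}. mism x i j off len = 0 \<and> mism x i j r rl = 1}"
proof -
  let ?p = "i + off + 1"
  have p: "?p \<in> {1..e}" using i off_len l_len m_less by auto
  have inc: "inc i j k = of_bool (j = ?p) * of_bool (hit ?p k) + of_bool (k = ?p) * of_bool (hit ?p j)" for j k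
    using hit_sym by (auto simp: inc_def)
  have "(\<Sum>j\<in>{1..e}. \<Sum>k\<in>set (ch j). of_bool (j = ?p) * of_bool (hit ?p k) :: nat) =
      (\<Sum>j\<in>{1..e}. of_bool (j = ?p) * (\<Sum>k\<in>set (ch ?p). of_bool (hit ?p k)))"
    by (intro sum.cong) auto
  also have "\<dots> = (\<Sum>k\<in>set (ch ?p). of_bool (hit ?p k))"
    using p by (simp flip: sum_distrib_right)
  also have "\<dots> = card {k \<in> set (ch ?p). hit ?p k}" by (simp add: Int_def)
  finally have 1: "(\<Sum>j\<in>{1..e}. \<Sum>k\<in>set (ch j). of_bool (j = ?p) * of_bool (hit ?p k)) =
      card {k \<in> set (ch ?p). hit ?p k}" .
  have "(\<Sum>j\<in>{1..e}. \<Sum>k\<in>set (ch j). of_bool (k = ?p) * of_bool (hit ?p j) :: nat) =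
      (\<Sum>j\<in>{1..e}. of_bool (?p \<in> set (ch j) \<and> hit ?p j))"
  proof (rule sum.cong[OF refl])
    fix j
    have "{k \<in> set (ch j). k = ?p} = (if ?p \<in> set (ch j) then {?p} else {})" by auto
    then show "(\<Sum>k\<in>set (ch j). of_bool (k = ?p) * of_bool (hit ?p j) :: nat) =
        of_bool (?p \<in> set (ch j) \<and> hit ?p j)"
      by (simp add: Int_def flip: sum_distrib_right)
  qed
  also have "\<dots> = card {j \<in> {1..e}. ?p \<in> set (ch j) \<and> hit ?p j}"
    by (simp only: sum_of_bool_eq finite_atLeastAtMost of_nat_id Collect_conj_eq Collect_mem_eq)
  finally have 2: "(\<Sum>j\<in>{1..e}. \<Sum>k\<in>set (ch j). of_bool (k = ?p) * of_bool (hit ?p j)) =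
      card {j \<in> {1..e}. ?p \<in> set (ch j) \<and> hit ?p j}" .
  \<comment> \<open>A hit agrees on \<open>len \<ge> l\<close> letters, so the codes are equal:
    following the links misses no hit.\<close>
  have hD: "D k = D ?p" if "hit ?p k" for k
    using that agree_mono[OF _ l_len] D_eq_iff[of ?p k] by (auto simp: hit_def)
  have sub: "1 \<le> k" "k \<le> e" "k \<noteq> j" if "j \<in> {1..e}" "k \<in> set (ch j)" for j k
    using ch[OF that(1)] that(2) by auto
  have once': "(k \<in> set (ch ?p)) \<noteq> (?p \<in> set (ch k))" if "k \<in> {1..e}" "k \<noteq> ?p" "hit ?p k" for k
    using once[OF p that(1)] that hD by simp
  have "{k \<in> set (ch ?p). hit ?p k} \<inter> {j \<in> {1..e}. ?p \<in> set (ch j) \<and> hit ?p j} = {}"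
    using once' sub(3)[OF p] by blast
  moreover have "{k \<in> set (ch ?p). hit ?p k} \<union> {j \<in> {1..e}. ?p \<in> set (ch j) \<and> hit ?p j} =
      {k \<in> {1..e}. k \<noteq> ?p \<and> hit ?p k}" (is "?L = ?R")
  proof (intro equalityI subsetI)
    fix k assume "k \<in> ?L"
    then show "k \<in> ?R" using sub[OF p, of k] sub(3)[of k ?p] by auto
  next
    fix k assume "k \<in> ?R"
    then show "k \<in> ?L" using once'[of k] by blast
  qed
  ultimately have 3: "(\<Sum>j\<in>{1..e}. \<Sum>k\<in>set (ch j). inc i j k) = card {k \<in> {1..e}. k \<noteq> ?p \<and> hit ?p k}"
    unfolding inc sum.distrib 1 2 by (subst card_Un_disjoint[symmetric]) auto
  have "{k \<in> {1..e}. k \<noteq> ?p \<and> hit ?p k} =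
      (\<lambda>j. j + off + 1) ` {j \<in> {0..n - m}. mism x i j off len = 0 \<and> mism x i j r rl = 1}"
    (is "_ = ?f ` ?B")
  proof (intro equalityI subsetI)
    fix k assume k: "k \<in> {k \<in> {1..e}. k \<noteq> ?p \<and> hit ?p k}"
    then have "off < k" "k < off + (n - m + 2)" by (auto simp: hit_def in_range_def)
    then obtain j where j: "k = j + off + 1" "j \<le> n - m"
      by (intro that[of "k - off - 1"]) auto
    with k hit_iff[OF i j(2)] show "k \<in> ?f ` ?B" by auto
  next
    fix k assume "k \<in> ?f ` ?B"
    then obtain j where j: "k = j + off + 1" "j \<le> n - m" "mism x i j off len = 0" "mism x i j r rl = 1"
      by auto
    \<comment> \<open>A factor has no mismatch with itself, so excluding \<open>k = ?p\<close> loses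
      nothing.\<close>
    moreover have "mism x i i r rl = 0" by (simp add: mism_def)
    ultimately have "j \<noteq> i" by auto
    moreover have "k \<in> {1..e}" using j off_len l_len m_less by auto
    ultimately show "k \<in> {k \<in> {1..e}. k \<noteq> ?p \<and> hit ?p k}" using j hit_iff[OF i j(2)] by auto
  qed
  moreover have "card (?f ` ?B) = card ?B" by (intro card_image) (auto simp: inj_on_def)
  ultimately show ?thesis unfolding 3 by simp
qed

text \<open>The windows must end inside the string because the padding digit 0 is also the rank of
  the smallest letter.\<close>

lemma agree_equal_windows:
  assumes "1 \<le> j" "1 \<le> k" "j - 1 + L \<le> n" "k - 1 + L \<le> n" "agree j k L"
  shows "equal_windows x (j - 1) (k - 1) L"
proof -
  have "x ! (j - 1 + t) = x ! (k - 1 + t)" if "t < L" for t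
  proof -
    have "digit x (j + t) = digit x (k + t)" using assms that by (simp add: agree_def)
    moreover have "j + t \<le> n" "k + t \<le> n" using assms that by linarith+
    ultimately have "x ! (j + t - 1) = x ! (k + t - 1)"
      using digit_eq_iff[of "j + t" x "k + t"] assms by simp
    moreover have "j + t - 1 = j - 1 + t" "k + t - 1 = k - 1 + t" using assms(1,2) by simp_all
    ultimately show ?thesis by (simp only:)
  qed
  with assms show ?thesis by (simp add: equal_windows_def)
qed

lemma pair_cost_le:
  assumes jk: "j \<in> {1..e}" "k \<in> {1..e}" "D j = D k" and h: "h \<le> len"
  shows "pair_cost j k \<le> work x m l (j - 1) (k - 1)"
proof -
  let ?w = "equal_windows x (j - 1) (k - 1)"
  have len_n: "j - 1 + L \<le> n" if "in_range j" "L \<le> len" for j L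
    using that off_len m_less by (auto simp: in_range_def)
  have L: "?w L" if "in_range j" "in_range k" "agree j k L" "L \<le> len" for L
    by (rule agree_equal_windows[OF _ _ len_n[OF that(1,4)] len_n[OF that(2,4)] that(3)]) (use jk in auto)
  have "?w l" using jk l_less by (intro agree_equal_windows) (auto simp: D_eq_iff)
  have "len \<le> n" using off_len m_less by linarith
  have "1 + (\<Sum>L\<in>{l<..len}. of_bool (in_range j \<and> in_range k \<and> agree j k L)) \<le>
      (1::nat) + (\<Sum>L\<in>{l<..len}. of_bool (?w L))"
    using L by (intro add_left_mono sum_mono) auto
  \<comment> \<open>The unit for the visit becomes the term \<open>L = l\<close>, as linked
    positions agree on \<open>l\<close> letters.\<close>
  also have "\<dots> = (\<Sum>L\<in>insert l {l<..len}. of_bool (?w L))" using \<open>?w l\<close> by simp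
  also have "\<dots> \<le> (\<Sum>L\<in>{l..n}. of_bool (?w L))"
    using l_len \<open>len \<le> n\<close> by (intro sum_mono2) auto
  finally have 1: "(1::nat) + (\<Sum>L\<in>{l<..len}. of_bool (in_range j \<and> in_range k \<and> agree j k L)) \<le>
      (\<Sum>L\<in>{l..n}. of_bool (?w L))" .
  have "?w h" if "in_range j" "in_range k" "agree j k len"
    using L[OF that(1,2) agree_mono[OF that(3) h] h] .
  then have "rl * of_bool (in_range j \<and> in_range k \<and> agree j k len) \<le> m * of_bool (?w h)"
    using r_rl by (intro mult_le_mono) auto
  with 1 show ?thesis by (simp only: pair_cost_def work_def add_le_mono)
qed

lemma sum_pair_cost:
  assumes ch: "\<And>j. j \<in> {1..e} \<Longrightarrow> set (ch j) \<subseteq> {k \<in> {1..e}. k \<noteq> j \<and> D k = D j}" and h: "h \<le> len"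
  shows "(\<Sum>j\<in>{1..e}. \<Sum>k\<in>set (ch j). pair_cost j k) \<le> total_work x m l"
proof -
  have en: "e \<le> n" using l1 l_less by linarith
  have "(\<Sum>j\<in>{1..e}. \<Sum>k\<in>set (ch j). pair_cost j k) \<le>
      (\<Sum>j\<in>{1..e}. \<Sum>q\<in>{..<n} - {j - 1}. work x m l (j - 1) q)"
  proof (rule sum_mono)
    fix j assume j: "j \<in> {1..e}"
    have "(\<Sum>k\<in>set (ch j). pair_cost j k) \<le> (\<Sum>k\<in>set (ch j). work x m l (j - 1) (k - 1))"
      using ch[OF j] j h by (intro sum_mono pair_cost_le) auto
    also have "\<dots> = (\<Sum>q\<in>(\<lambda>k. k - 1) ` set (ch j). work x m l (j - 1) q)"
    proof -
      have "inj_on (\<lambda>k. k - 1) (set (ch j))"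
      proof (rule inj_onI)
        fix a b assume "a \<in> set (ch j)" "b \<in> set (ch j)" "a - 1 = b - 1"
        moreover from this ch[OF j] have "1 \<le> a" "1 \<le> b" by auto
        ultimately show "a = b" by linarith
      qed
      then show ?thesis by (simp add: sum.reindex)
    qed
    also have "\<dots> \<le> (\<Sum>q\<in>{..<n} - {j - 1}. work x m l (j - 1) q)"
    proof (intro sum_mono2)
      show "(\<lambda>k. k - 1) ` set (ch j) \<subseteq> {..<n} - {j - 1}"
      proof
        fix q assume "q \<in> (\<lambda>k. k - 1) ` set (ch j)"
        then obtain k where k: "k \<in> set (ch j)" "q = k - 1" by auto
        with ch[OF j] have "1 \<le> k" "k \<le> e" "k \<noteq> j" by auto
        moreover have "1 \<le> j" using j by simp
        ultimately have "q < n" "q \<noteq> j - 1" using k(2) en by linarith+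
        then show "q \<in> {..<n} - {j - 1}" by simp
      qed
    qed auto
    finally show "(\<Sum>k\<in>set (ch j). pair_cost j k) \<le> \<dots>" .
  qed
  also have "\<dots> = (\<Sum>p\<in>(\<lambda>j. j - 1) ` {1..e}. \<Sum>q\<in>{..<n} - {p}. work x m l p q)"
    by (subst sum.reindex) (auto simp: inj_on_def)
  also have "\<dots> \<le> total_work x m l"
    unfolding total_work_def using en by (intro sum_mono2) auto
  finally show ?thesis .
qed

end

section \<open>The two passes together\<close>

context mapp_window
begin

lemma passes: "mapp_pass x m W l 0 h h (m - h)" "mapp_pass x m W l h (m - h) 0 h"
  by unfold_locales (use l_le in auto)

lemma wp_main:
  assumes v: "frame v" "v rS = s" "v rB = s ^ (l - 1)"
    and A: "\<forall>k. k \<noteq> 1 \<longrightarrow> A k = init k" "\<forall>c \<le> n. A 1 c = rank x c"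
    and Q: "\<And>v' A' T'. \<forall>i \<le> n - m. A' 0 i = mappability1 x m ! i \<Longrightarrow>
      T' \<le> T + 500 * n + 700 + 640 * total_work x m l \<Longrightarrow> Q v' A' T'"
  shows "wp W S main Q v A T"
proof -
  interpret a: mapp_pass x m W l 0 h h "m - h" by (rule passes)
  interpret b: mapp_pass x m W l h "m - h" 0 h by (rule passes)
  have hm: "h \<le> m - h" "m - h \<le> m" "h \<le> m" by simp_all
  have en: "e \<le> n" using l1 l_less by linarith
  have hamming: "hamming_dist (factor x i (i + m - 1)) (factor x j (j + m - 1)) =
      mism x i j 0 h + mism x i j h (m - h)" for i j
    by (rule hamming_factor) (use m2 in auto)
  show ?thesis
    unfolding main_def wp_Seq[of _ _ coding] wp_Seq[of _ _ buckets] wp_Seq[of _ _ linking]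
  proof (rule wp_coding[OF v A])
    fix v1 :: vars and A1 :: arrays and T1 :: nat
    assume 1: "frame v1" "\<forall>i. A1 0 i = 0" "\<forall>i<S. A1 2 i = digit x i"
      "\<forall>i. 1 \<le> i \<longrightarrow> i \<le> n \<longrightarrow> A1 3 i = D i" "\<forall>k\<ge>4. \<forall>i. A1 k i = 0" "T1 \<le> T + 100 * n + 100"
    show "wp W S buckets (wp W S linking (wp W S (rO ::= Lit 0 ;; rLen ::= Var rH ;; rR ::= Var rH ;;
      rRl ::= Var rM [-] Var rH ;; pairs ;; rO ::= Var rH ;; rLen ::= Var rM [-] Var rH ;;
      rR ::= Lit 0 ;; rRl ::= Var rH ;; pairs) Q)) v1 A1 T1"
    proof (rule wp_buckets[OF 1(1,4,5)])
      fix v2 :: vars and A2 :: arrays and T2 :: nat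
      assume 2: "frame v2" "v2 rE = e" "\<forall>k. k \<noteq> 4 \<longrightarrow> k \<noteq> 5 \<longrightarrow> A2 k = A1 k"
        "\<forall>u. linked (A2 5) (A2 4 u) (rev (filter (\<lambda>i. D i div n = u) [1..<e + 1]))"
        "T2 \<le> T1 + 50 * n + 100"
      have A2: "\<forall>i. 1 \<le> i \<longrightarrow> i \<le> n \<longrightarrow> A2 3 i = D i" "A2 6 = (\<lambda>_. 0)"
        "\<forall>i. A2 0 i = 0" "\<forall>i<S. A2 2 i = digit x i"
        using 1(2-5) 2(3) by auto
      show "wp W S linking (wp W S (rO ::= Lit 0 ;; rLen ::= Var rH ;; rR ::= Var rH ;;
        rRl ::= Var rM [-] Var rH ;; pairs ;; rO ::= Var rH ;; rLen ::= Var rM [-] Var rH ;;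
        rR ::= Lit 0 ;; rRl ::= Var rH ;; pairs) Q) v2 A2 T2"
      proof (rule wp_linking[OF 2(1,2) A2(1,2) 2(4)])
        fix v3 :: vars and A3 :: arrays and T3 :: nat and R :: "nat list"
        assume 3: "frame v3" "v3 rE = e" "\<forall>k. k \<noteq> 6 \<longrightarrow> k \<noteq> 7 \<longrightarrow> A3 k = A2 k"
          "same_key_links D (A3 7) R" "distinct R" "set R = {1..e}" "T3 \<le> T2 + 100 * n + 100"
        have A3: "\<forall>i. A3 0 i = 0" "\<forall>i<S. A3 2 i = digit x i"
          using A2 3(3) by simp_all
        obtain ch where ch: "\<And>j. j \<in> {1..e} \<Longrightarrow> linked (A3 7) (A3 7 j) (ch j)"
          "\<And>j. j \<in> {1..e} \<Longrightarrow> distinct (ch j)"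
          "\<And>j. j \<in> {1..e} \<Longrightarrow> set (ch j) \<subseteq> {k \<in> {1..e}. k \<noteq> j \<and> D k = D j}" and
          once: "\<And>j k. j \<in> {1..e} \<Longrightarrow> k \<in> {1..e} \<Longrightarrow> j \<noteq> k \<Longrightarrow> D j = D k \<Longrightarrow>
            (k \<in> set (ch j)) \<noteq> (j \<in> set (ch k))"
          using same_key_chains[OF 3(4,5)] unfolding 3(6) by (elim exE conjE) blast
        let ?v = "v3(rO := 0, rLen := h, rR := h, rRl := m - h)"
        have pairs1: "wp W S pairs (wp W S (rO ::= Var rH ;; rLen ::= Var rM [-] Var rH ;;
          rR ::= Lit 0 ;; rRl ::= Var rH ;; pairs) Q) ?v A3 T4" if T4: "T4 \<le> T3 + 20" for T4
        proof (rule a.wp_pairs[of ?v A3 ch])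
          show "a.pframe ?v" using 3 by (auto simp: a.pframe_def frame_def)
          fix v5 :: vars and A5 :: arrays and T5 :: nat
          assume 5: "a.pframe v5" "\<forall>k. k \<noteq> 0 \<longrightarrow> A5 k = A3 k"
            "\<forall>i. A5 0 i = A3 0 i + (\<Sum>j\<in>{1..e}. \<Sum>k\<in>set (ch j). a.inc i j k)"
            "T5 \<le> T4 + 100 + 100 * n + 320 * (\<Sum>j\<in>{1..e}. \<Sum>k\<in>set (ch j). a.pair_cost j k)"
          have A5: "A5 2 = A3 2" "A5 7 = A3 7" using 5(2) by simp_all
          let ?v = "v5(rO := h, rLen := m - h, rR := 0, rRl := h)"
          have pairs2: "wp W S pairs Q ?v A5 T6" if T6: "T6 \<le> T5 + 20" for T6
          proof (rule b.wp_pairs[of ?v A5 ch])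
            show "b.pframe ?v" using 5(1) by (auto simp: a.pframe_def b.pframe_def frame_def)
            \<comment> \<open>The second pass adds to the counters of the first, whose size is
              therefore needed to exclude overflow.\<close>
            have s1: "(\<Sum>j\<in>{1..e}. \<Sum>k\<in>set (ch j). a.inc i j k) \<le> (\<Sum>j\<in>{1..e}. 2 * n)" for i
            proof (rule sum_mono)
              fix j assume j: "j \<in> {1..e}"
              have "(\<Sum>k\<in>set (ch j). a.inc i j k) \<le> of_nat (card (set (ch j))) * 2"
                by (intro sum_bounded_above a.inc_le)
              also have "card (set (ch j)) \<le> card {1..e}"
                using ch(3)[OF j] by (intro card_mono) blast+
              finally show "(\<Sum>k\<in>set (ch j). a.inc i j k) \<le> 2 * n" using en by simp
            qed
            have s2: "(\<Sum>j\<in>{1..e}. 2 * n) \<le> 4 * (S * S)"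
            proof -
              have "(\<Sum>j\<in>{1..e}. 2 * n) = e * (2 * n)" by simp
              also have "\<dots> \<le> S * (4 * S)" using en by (intro mult_le_mono) auto
              finally show ?thesis by (simp only: mult.left_commute)
            qed
            show "\<forall>i. A5 0 i \<le> 4 * (S * S)"
              unfolding 5(3)[rule_format] A3(1)[rule_format] add_0 using order_trans[OF s1 s2] by blast
            fix v7 :: vars and A7 :: arrays and T7 :: nat
            assume 7: "\<forall>i. A7 0 i = A5 0 i + (\<Sum>j\<in>{1..e}. \<Sum>k\<in>set (ch j). b.inc i j k)"
              "T7 \<le> T6 + 100 + 100 * n + 320 * (\<Sum>j\<in>{1..e}. \<Sum>k\<in>set (ch j). b.pair_cost j k)"
            show "Q v7 A7 T7"
            proof (rule Q)
              have "(\<Sum>j\<in>{1..e}. \<Sum>k\<in>set (ch j). a.pair_cost j k) \<le> total_work x m l"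
                "(\<Sum>j\<in>{1..e}. \<Sum>k\<in>set (ch j). b.pair_cost j k) \<le> total_work x m l"
                by (rule a.sum_pair_cost[OF ch(3)] b.sum_pair_cost[OF ch(3)]; simp)+
              then show "T7 \<le> T + 500 * n + 700 + 640 * total_work x m l"
                using 7(2) T6 5(4) T4 3(7) 2(5) 1(6) by linarith
              show "\<forall>i\<le>n - m. A7 0 i = mappability1 x m ! i"
              proof (intro allI impI)
                fix i assume i: "i \<le> n - m"
                let ?A = "{j \<in> {0..n - m}. mism x i j 0 h = 0 \<and> mism x i j h (m - h) = 1}"
                let ?B = "{j \<in> {0..n - m}. mism x i j h (m - h) = 0 \<and> mism x i j 0 h = 1}"
                have "(\<Sum>j\<in>{1..e}. \<Sum>k\<in>set (ch j). a.inc i j k) = card ?A"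
                  using ch(3) once i by (rule a.sum_inc)
                moreover have "(\<Sum>j\<in>{1..e}. \<Sum>k\<in>set (ch j). b.inc i j k) = card ?B"
                  using ch(3) once i by (rule b.sum_inc)
                ultimately have "A7 0 i = card ?A + card ?B"
                  unfolding 7(1)[rule_format] 5(3)[rule_format] A3(1)[rule_format] add_0 by (rule arg_cong2)
                \<comment> \<open>At distance 1 the mismatch lies in exactly one half, so no factor
                  is counted by both passes.\<close>
                also have "\<dots> = card (?A \<union> ?B)" by (intro card_Un_disjoint[symmetric]) auto
                also have "?A \<union> ?B = {j \<in> {0..n - m}.
                    hamming_dist (factor x i (i + m - 1)) (factor x j (j + m - 1)) = 1}"
                  unfolding hamming by (auto simp: add_is_1)
                also have "card \<dots> = mappability1 x m ! i"
                  unfolding mappability1_def using i by (subst nth_map) (auto simp del: upt_Suc)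
                finally show "A7 0 i = mappability1 x m ! i" .
              qed
            qed
          qed (use ch A3 A5 in simp_all)
          have regs: "v5 rH = h" "v5 rM = m" using 5(1) by (simp_all add: a.pframe_def frame_def)
          show "wp W S (rO ::= Var rH ;; rLen ::= Var rM [-] Var rH ;;
            rR ::= Lit 0 ;; rRl ::= Var rH ;; pairs) Q v5 A5 T5"
            using pairs2 regs W_lin m_less hm by simp
        qed (use ch A3 in simp_all)
        have regs: "v3 rH = h" "v3 rM = m" using 3(1) by (simp_all add: frame_def)
        show "wp W S (rO ::= Lit 0 ;; rLen ::= Var rH ;; rR ::= Var rH ;;
          rRl ::= Var rM [-] Var rH ;; pairs ;; rO ::= Var rH ;; rLen ::= Var rM [-] Var rH ;;
          rR ::= Lit 0 ;; rRl ::= Var rH ;; pairs) Q v3 A3 T3"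
          using pairs1 regs W_lin m_less hm
          by (simp del: wp_Seq add: wp_Seq[of _ _ "_ ::= _"] wp_Seq[of _ _ pairs])
      qed
    qed
  qed
qed

end

context mapp
begin

lemma wp_prog:
  assumes v: "v rN = n" "v rM = m" and A: "A = init"
    and Q: "\<And>v' A' T' l. l = h \<or> n \<le> s ^ l \<Longrightarrow> \<forall>i \<le> n - m. A' 0 i = mappability1 x m ! i \<Longrightarrow>
      T' \<le> T + 1000 * n + 1000 + 640 * total_work x m l \<Longrightarrow> Q v' A' T'"
  shows "wp W S prog Q v A T"
  unfolding prog_def wp_Seq
proof (rule wp_presence[OF assms(1-3)])
  fix v1 :: vars and A1 :: arrays and T1 :: nat
  assume 1: "v1 rN = n" "v1 rM = m" "\<forall>k. k \<noteq> 1 \<longrightarrow> A1 k = init k"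
    "\<forall>c. A1 1 c = of_bool (c \<in> set x)" "T1 \<le> T + 50 * n + 50"
  show "wp W S ranking (wp W S window_length (wp W S main Q)) v1 A1 T1"
  proof (rule wp_ranking[OF 1(1-4)])
    fix v2 :: vars and A2 :: arrays and T2 :: nat
    assume 2: "v2 rN = n" "v2 rM = m" "v2 rS = s" "\<forall>k. k \<noteq> 1 \<longrightarrow> A2 k = init k"
      "\<forall>c \<le> n. A2 1 c = rank x c" "T2 \<le> T1 + 50 * n + 100"
    show "wp W S window_length (wp W S main Q) v2 A2 T2"
    proof (rule wp_window_length[OF 2(1-3)])
      fix v3 :: vars and T3 l :: nat
      assume 3: "v3 rN = n" "v3 rM = m" "v3 rS = s" "v3 rH = h" "v3 rL = l"
        "v3 rB = s ^ (l - 1)" "1 \<le> l" "l \<le> h" "s ^ (l - 1) < n" "l = h \<or> n \<le> s ^ l"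
        "T3 \<le> T2 + 50 * n + 100"
      interpret mapp_window x m W l by unfold_locales (use 3 in auto)
      show "wp W S main Q v3 A2 T3"
      proof (rule wp_main)
        fix v' :: vars and A' :: arrays and T' :: nat
        assume "\<forall>i \<le> n - m. A' 0 i = mappability1 x m ! i"
          "T' \<le> T3 + 500 * n + 700 + 640 * total_work x m l"
        then show "Q v' A' T'" using 3(10,11) 2(6) 1(5) by (intro Q) auto
      qed (use 2 3 in \<open>simp_all add: frame_def\<close>)
    qed
  qed
qed

end

section \<open>Average-case analysis\<close>

definition strings :: "nat \<Rightarrow> 'a set \<Rightarrow> 'a list set" where
  "strings n \<Sigma> = {x. set x \<subseteq> \<Sigma> \<and> length x = n}"

lemma finite_strings: "finite \<Sigma> \<Longrightarrow> finite (strings n \<Sigma>)"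
  unfolding strings_def by (rule finite_lists_length_eq)

lemma card_strings: "finite \<Sigma> \<Longrightarrow> card (strings n \<Sigma>) = card \<Sigma> ^ n"
  unfolding strings_def by (rule card_lists_length_eq)

lemma pmf_replicate_pmf_of_set:
  assumes "finite \<Sigma>" "\<Sigma> \<noteq> {}" "x \<in> strings n \<Sigma>"
  shows "pmf (replicate_pmf n (pmf_of_set \<Sigma>)) x = 1 / real (card \<Sigma>) ^ n"
  using assms(3)
proof (induction n arbitrary: x)
  case 0
  then show ?case by (simp add: strings_def)
next
  case (Suc n)
  then obtain a y where x: "x = a # y" "a \<in> \<Sigma>" "y \<in> strings n \<Sigma>"
    by (cases x) (auto simp: strings_def)
  let ?p = "pmf_of_set \<Sigma>" and ?q = "replicate_pmf n (pmf_of_set \<Sigma>)"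
  have "replicate_pmf (Suc n) ?p = map_pmf (\<lambda>z. fst z # snd z) (pair_pmf ?p ?q)"
    by (simp add: pair_pmf_def map_pmf_def bind_assoc_pmf bind_return_pmf)
  moreover have "pmf (map_pmf (\<lambda>z. fst z # snd z) (pair_pmf ?p ?q)) (fst (a, y) # snd (a, y)) =
      pmf (pair_pmf ?p ?q) (a, y)"
    by (rule pmf_map_inj') (auto simp: inj_on_def prod_eq_iff)
  ultimately show ?case
    using x assms(1,2) Suc.IH[OF x(3)] by (simp add: pmf_pair)
qed

text \<open>Independent uniform letters make all strings of length \<open>n\<close> equally likely,
  so the expectation is a plain average and the analysis reduces to counting.\<close>

lemma expectation_replicate_pmf_of_set:
  fixes f :: "'a list \<Rightarrow> real"
  assumes "finite \<Sigma>" "\<Sigma> \<noteq> {}"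
  shows "measure_pmf.expectation (replicate_pmf n (pmf_of_set \<Sigma>)) f =
    (\<Sum>x\<in>strings n \<Sigma>. f x) / real (card \<Sigma>) ^ n"
proof -
  have "measure_pmf.expectation (replicate_pmf n (pmf_of_set \<Sigma>)) f =
      (\<Sum>x\<in>strings n \<Sigma>. f x * pmf (replicate_pmf n (pmf_of_set \<Sigma>)) x)"
    using assms
    by (intro integral_measure_pmf_real finite_strings)
      (auto simp: set_replicate_pmf strings_def lists_eq_set)
  also have "\<dots> = (\<Sum>x\<in>strings n \<Sigma>. f x / real (card \<Sigma>) ^ n)"
    by (intro sum.cong refl) (simp add: pmf_replicate_pmf_of_set assms)
  finally show ?thesis by (simp add: sum_divide_distrib)
qed

lemma equal_windows_sym: "equal_windows x p q L \<longleftrightarrow> equal_windows x q p L"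
  by (auto simp: equal_windows_def)

text \<open>If two windows of a string agree, the later one can be cut out and recovered letter by letter
  from the rest, even if the windows overlap.\<close>

lemma card_equal_windows_less:
  assumes "finite \<Sigma>" "p < q"
  shows "card {x \<in> strings n \<Sigma>. equal_windows x p q L} * card \<Sigma> ^ L \<le> card \<Sigma> ^ n"
proof (cases "q + L \<le> n")
  case True
  let ?X = "{x \<in> strings n \<Sigma>. equal_windows x p q L}"
  let ?f = "\<lambda>x. take q x @ drop (q + L) x"
  have "inj_on ?f ?X"
  proof (rule inj_onI)
    fix x y assume xy: "x \<in> ?X" "y \<in> ?X" "?f x = ?f y"
    then have len: "length x = n" "length y = n" by (auto simp: strings_def)
    with xy True have tk: "take q x = take q y" and dr: "drop (q + L) x = drop (q + L) y"
      by (auto simp: append_eq_append_conv)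
    have "i < n \<longrightarrow> x ! i = y ! i" for i
    proof (induction i rule: less_induct)
      case (less i)
      consider "i < q" | "q \<le> i" "i < q + L" | "q + L \<le> i" by linarith
      then show ?case
      proof cases
        case 1
        then show ?thesis using tk by (metis nth_take)
      next
        case 2
        define t where "t = i - q"
        have t: "i = q + t" "t < L" using 2 by (auto simp: t_def)
        then have "x ! (q + t) = x ! (p + t)" "y ! (q + t) = y ! (p + t)"
          using xy by (auto simp: equal_windows_def)
        with less[of "p + t"] t True \<open>p < q\<close> show ?thesis by simp
      next
        case 3
        show ?thesis
        proof
          assume "i < n"
          with 3 len have "x ! i = drop (q + L) x ! (i - (q + L))" "y ! i = drop (q + L) y ! (i - (q + L))"
            by simp_all
          with dr show "x ! i = y ! i" by simp
        qed
      qed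
    qed
    with len show "x = y" by (intro nth_equalityI) auto
  qed
  moreover have "?f ` ?X \<subseteq> strings (n - L) \<Sigma>"
    using True by (auto simp: strings_def dest!: in_set_takeD in_set_dropD)
  ultimately have "card ?X \<le> card \<Sigma> ^ (n - L)"
    using card_inj_on_le[of ?f ?X "strings (n - L) \<Sigma>"] assms by (simp add: finite_strings card_strings)
  then have "card ?X * card \<Sigma> ^ L \<le> card \<Sigma> ^ (n - L) * card \<Sigma> ^ L" by (rule mult_right_mono) simp
  also have "\<dots> = card \<Sigma> ^ n" using True by (simp flip: power_add)
  finally show ?thesis .
next
  case False
  then have "{x \<in> strings n \<Sigma>. equal_windows x p q L} = {}"
    by (auto simp: strings_def equal_windows_def)
  then show ?thesis by (simp only: card.empty mult_0 zero_le)
qed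

lemma card_equal_windows:
  assumes "finite \<Sigma>" "p \<noteq> q"
  shows "card {x \<in> strings n \<Sigma>. equal_windows x p q L} * card \<Sigma> ^ L \<le> card \<Sigma> ^ n"
proof (cases "p < q")
  case True
  with assms show ?thesis by (intro card_equal_windows_less)
next
  case False
  with assms card_equal_windows_less[of \<Sigma> q p n L] show ?thesis
    by (simp add: equal_windows_sym[of _ p q])
qed

lemma sum_equal_windows:
  assumes "finite \<Sigma>" "\<Sigma> \<noteq> {}" "p \<noteq> q"
  shows "(\<Sum>x\<in>strings n \<Sigma>. of_bool (equal_windows x p q L)) \<le>
    real (card \<Sigma>) ^ n * (1 / real (card \<Sigma>)) ^ L"
proof -
  have "real (card {x \<in> strings n \<Sigma>. equal_windows x p q L} * card \<Sigma> ^ L) \<le> real (card \<Sigma> ^ n)"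
    using card_equal_windows[OF assms(1,3)] by (simp only: of_nat_le_iff)
  moreover have "0 < card \<Sigma>" using assms by (simp add: card_gt_0_iff)
  ultimately have "real (card {x \<in> strings n \<Sigma>. equal_windows x p q L}) \<le>
      real (card \<Sigma>) ^ n / real (card \<Sigma>) ^ L"
    by (simp add: field_simps)
  moreover have "strings n \<Sigma> \<inter> {x. equal_windows x p q L} = {x \<in> strings n \<Sigma>. equal_windows x p q L}"
    by blast
  ultimately show ?thesis using assms by (simp add: finite_strings power_one_over divide_inverse power_inverse)
qed

lemma geometric_tail:
  fixes z :: real
  assumes "0 \<le> z" "z \<le> 1 / 2"
  shows "(\<Sum>L\<in>{l..n}. z ^ L) \<le> 2 * z ^ l"
proof -
  \<comment> \<open>The factor \<open>1 - (1 / 2) ^ k\<close> makes the bound inductive: it leaves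
    room for the next term.\<close>
  have "(\<Sum>L\<in>{l..<l + k}. z ^ L) \<le> 2 * z ^ l * (1 - (1 / 2) ^ k)" for k
  proof (induction k)
    case (Suc k)
    have "z ^ (l + k) \<le> z ^ l * (1 / 2) ^ k"
      unfolding power_add using assms by (intro mult_left_mono power_mono) auto
    with Suc.IH show ?case by (simp add: algebra_simps)
  qed simp
  also have "2 * z ^ l * (1 - (1 / 2) ^ k) \<le> 2 * z ^ l * 1" for k
    using assms by (intro mult_left_mono) auto
  finally have "(\<Sum>L\<in>{l..<l + (Suc n - l)}. z ^ L) \<le> 2 * z ^ l * 1" .
  moreover have "{l..n} \<subseteq> {l..<l + (Suc n - l)}" by auto
  ultimately show ?thesis
    using sum_mono2[of "{l..<l + (Suc n - l)}" "{l..n}" "\<lambda>L. z ^ L"] assms by simp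
qed

text \<open>The mean work of an ordered pair is at most \<open>5 / n\<close>: the geometric series
  gives \<open>2 / \<sigma> ^ l \<le> 2 / n\<close>, and the mismatches give
  \<open>m / \<sigma> ^ (m div 2) \<le> 3 / n\<close>. There are fewer than \<open>n * n\<close>
  pairs.\<close>

lemma sum_total_work:
  assumes "finite \<Sigma>" "2 \<le> card \<Sigma>" "n \<le> card \<Sigma> ^ l" "n * m \<le> 3 * card \<Sigma> ^ (m div 2)"
  shows "(\<Sum>x\<in>strings n \<Sigma>. real (total_work x m l)) \<le> real (card \<Sigma>) ^ n * (5 * real n)"
proof -
  let ?s = "real (card \<Sigma>)"
  have ne: "\<Sigma> \<noteq> {}" using assms(2) by auto
  have s2: "2 \<le> ?s" using assms(2) by simp
  have pair: "(\<Sum>x\<in>strings n \<Sigma>. real (work x m l p q)) * real n \<le> ?s ^ n * 5"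
    if "p \<noteq> q" for p q
  proof -
    have "(\<Sum>x\<in>strings n \<Sigma>. real (work x m l p q)) =
        (\<Sum>x\<in>strings n \<Sigma>. (\<Sum>L\<in>{l..n}. of_bool (equal_windows x p q L)) +
          real m * of_bool (equal_windows x p q (m div 2)))"
      by (intro sum.cong) (auto simp: work_def strings_def)
    also have "\<dots> = (\<Sum>L\<in>{l..n}. \<Sum>x\<in>strings n \<Sigma>. of_bool (equal_windows x p q L)) +
        real m * (\<Sum>x\<in>strings n \<Sigma>. of_bool (equal_windows x p q (m div 2)))"
      unfolding sum.distrib by (subst sum.swap) (simp only: sum_distrib_left)
    also have "\<dots> \<le> (\<Sum>L\<in>{l..n}. ?s ^ n * (1 / ?s) ^ L) + real m * (?s ^ n * (1 / ?s) ^ (m div 2))"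
      using assms(1) ne that by (intro add_mono sum_mono mult_left_mono sum_equal_windows) auto
    also have "(\<Sum>L\<in>{l..n}. ?s ^ n * (1 / ?s) ^ L) \<le> ?s ^ n * (2 * (1 / ?s) ^ l)"
      unfolding sum_distrib_left[symmetric] using s2 by (intro mult_left_mono geometric_tail) auto
    finally have "(\<Sum>x\<in>strings n \<Sigma>. real (work x m l p q)) * real n \<le>
        (?s ^ n * (2 * (1 / ?s) ^ l) + real m * (?s ^ n * (1 / ?s) ^ (m div 2))) * real n"
      by (simp add: mult_right_mono)
    also have "\<dots> = ?s ^ n * (2 * (real n / ?s ^ l) + real (n * m) / ?s ^ (m div 2))"
      by (simp add: field_simps power_one_over)
    also have "\<dots> \<le> ?s ^ n * (2 * 1 + 3)"
    proof (intro mult_left_mono add_mono)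
      have "real n \<le> ?s ^ l" using assms(3) by (metis of_nat_le_iff of_nat_power)
      then show "real n / ?s ^ l \<le> 1" using s2 by (simp add: divide_le_eq)
      have "real (n * m) \<le> 3 * ?s ^ (m div 2)"
        using assms(4) by (metis of_nat_le_iff of_nat_mult of_nat_numeral of_nat_power)
      then show "real (n * m) / ?s ^ (m div 2) \<le> 3" using s2 by (simp add: divide_le_eq)
    qed (use s2 in auto)
    finally show ?thesis by simp
  qed
  show ?thesis
  proof (cases "n = 0")
    case True
    then show ?thesis by (auto simp: total_work_def strings_def)
  next
    case False
    have "(\<Sum>x\<in>strings n \<Sigma>. real (total_work x m l)) =
        (\<Sum>x\<in>strings n \<Sigma>. \<Sum>p<n. \<Sum>q\<in>{..<n} - {p}. real (work x m l p q))"
      by (intro sum.cong) (auto simp: total_work_def strings_def)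
    also have "\<dots> = (\<Sum>p<n. \<Sum>q\<in>{..<n} - {p}. \<Sum>x\<in>strings n \<Sigma>. real (work x m l p q))"
      by (subst sum.swap, intro sum.cong refl, subst sum.swap, rule refl)
    also have "\<dots> \<le> (\<Sum>p<n. \<Sum>q\<in>{..<n} - {p}. ?s ^ n * 5 / real n)"
      using pair False by (intro sum_mono) (auto simp: pos_le_divide_eq)
    also have "\<dots> \<le> (\<Sum>p<n. \<Sum>q<n. ?s ^ n * 5 / real n)"
      by (intro sum_mono sum_mono2) auto
    also have "\<dots> = ?s ^ n * (5 * real n)" using False by simp
    finally show ?thesis .
  qed
qed

section \<open>The parameters\<close>

text \<open>Sixth powers clear the denominators in the exponents: \<open>n\<close> is at most the \<open>(m - 3) / 3\<close>-th power
  of \<open>\<sigma>\<close>, and \<open>m div 2 \<ge> (m - 1) / 2\<close>.\<close>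

lemma power6_le: "m ^ 6 \<le> 729 * 2 ^ (m + 3)" for m :: nat
proof (cases "9 \<le> m")
  case True
  then show ?thesis
  proof (induction m rule: dec_induct)
    case (step k)
    \<comment> \<open>As \<open>(10 / 9) ^ 6 < 2\<close>, from 9 on a step at most doubles the sixth
      power, while the right-hand side doubles.\<close>
    have "9 * Suc k \<le> 10 * k" using step.hyps by simp
    then have "(9 * Suc k) ^ 6 \<le> (10 * k) ^ 6" by (rule power_mono) simp
    then have "531441 * Suc k ^ 6 \<le> 1000000 * k ^ 6" unfolding power_mult_distrib by simp
    then have "Suc k ^ 6 \<le> 2 * k ^ 6" by linarith
    also have "\<dots> \<le> 2 * (729 * 2 ^ (k + 3))" using step.IH by simp
    finally show ?case unfolding add_Suc power_Suc by (simp only: mult.left_commute)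
  qed simp
next
  case False
  then have "m \<in> {0,1,2,3,4,5,6,7,8}" by auto
  then show ?thesis by auto
qed

lemma block_bounds:
  fixes n m s :: nat
  assumes "2 \<le> s" "2 \<le> n" "real m \<ge> 3 * (ln (real n) / ln (real s)) + 3"
  shows "4 \<le> m" "n * m \<le> 3 * s ^ (m div 2)"
proof -
  have ln: "0 < ln (real s)" "0 < ln (real n)" using assms by auto
  then have "0 < ln (real n) / ln (real s)" by simp
  with assms(3) show m: "4 \<le> m" by linarith
  have "3 * ln (real n) \<le> (real m - 3) * ln (real s)"
    using assms(3) ln by (simp add: field_simps)
  then have "ln (real n ^ 3) \<le> ln (real s ^ (m - 3))"
    using m assms by (simp add: ln_realpow of_nat_diff)
  then have "real n ^ 3 \<le> real s ^ (m - 3)" using assms by (subst (asm) ln_le_cancel_iff) auto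
  then have "n ^ 3 \<le> s ^ (m - 3)" by (metis of_nat_le_iff of_nat_power)
  then have "(n ^ 3) ^ 2 \<le> (s ^ (m - 3)) ^ 2" by (rule power_mono) simp
  then have n6: "n ^ 6 \<le> s ^ (2 * m - 6)"
    by (simp add: power_mult[symmetric] diff_mult_distrib2 mult.commute)
  have "m ^ 6 \<le> 729 * 2 ^ (m + 3)" by (rule power6_le)
  also have "\<dots> \<le> 729 * s ^ (m + 3)" using assms by (intro mult_left_mono power_mono) auto
  finally have "(n * m) ^ 6 \<le> s ^ (2 * m - 6) * (729 * s ^ (m + 3))"
    unfolding power_mult_distrib using n6 by (intro mult_le_mono) auto
  also have "\<dots> = 729 * s ^ (2 * m - 6 + (m + 3))" by (simp add: power_add)
  \<comment> \<open>The exponents add up to \<open>3 * m - 3\<close>, at most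
    \<open>6 * (m div 2)\<close> for either parity of \<open>m\<close>. The factor 729 is
    \<open>3 ^ 6\<close>.\<close>
  also have "\<dots> \<le> 729 * s ^ (6 * (m div 2))"
    using assms m by (intro mult_left_mono power_increasing) auto
  also have "\<dots> = (3 * s ^ (m div 2)) ^ 6"
    by (simp add: power_mult_distrib power_mult[symmetric] mult.commute)
  finally show "n * m \<le> 3 * s ^ (m div 2)" by (rule power_le_imp_le_base[where n = 5, simplified]) simp
qed

text \<open>This exchanges the window length of a run, which varies with the string, for a fixed
  lower bound before averaging.\<close>

lemma total_work_mono: "l \<le> l' \<Longrightarrow> total_work x m l' \<le> total_work x m l"
  unfolding total_work_def work_def by (intro sum_mono add_mono sum_mono2) auto

section \<open>The machine program\<close>

text \<open>The first two instructions put the array length \<open>n + 2\<close> into register 31.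
  Jumps are absolute, so the rest is compiled for position 2.\<close>

definition ram_prog :: program where
  "ram_prog = [Const 31 2, Op Add 31 31 0] @ compile prog 2"

lemma ram_prog_correct:
  assumes letters: "set x \<subseteq> {1..length x}" and m: "2 \<le> m" "m < length x"
    and w: "64 * ((length x + 2) * (length x + 2)) \<le> 2 ^ w"
  shows "\<exists>l. (l = m div 2 \<or> length x \<le> card (set x) ^ l) \<and>
    solves_mappability1 w ram_prog x m \<and>
    run_space w ram_prog (input_state x m) \<le> 8 * (length x + 2) \<and>
    run_time w ram_prog (input_state x m) \<le> 1002 + 1000 * length x + 640 * total_work x m l"
proof -
  interpret mapp x m "2 ^ w" by unfold_locales (use assms in auto)
  let ?v = "(\<lambda>_. 0)(0 := n, 1 := m) :: vars"
  define Q where "Q = (\<lambda>(v :: vars) (A :: arrays) T. \<exists>l. (l = h \<or> n \<le> s ^ l) \<and>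
    (\<forall>i \<le> n - m. A 0 i = mappability1 x m ! i) \<and> T \<le> 1000 * n + 1000 + 640 * total_work x m l)"
  have "wp (2 ^ w) S prog Q ?v init 0"
    by (rule wp_prog) (auto simp: Q_def)
  then obtain t v' A' where big: "big (2 ^ w) S prog ?v init t v' A'" and Q: "Q v' A' t"
    unfolding wp_def by auto
  have S: "8 * S \<le> 2 ^ w" using W_lin by linarith
  let ?s = "input_state x m"
  let ?s2 = "?s\<lparr>pc := 2, regs := (regs ?s)(31 := n + 2)\<rparr>"
  have "n + 2 < 100 * (n + 2)" by simp
  then have W2: "n + 2 < 2 ^ w" using W_lin by (rule less_le_trans)
  then have W2': "2 < (2::nat) ^ w" by linarith
  have "reach w (8 * S) ram_prog (Suc (Suc 0)) ?s ?s2"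
    apply (rule reach.further)
      apply (simp add: ram_prog_def input_state_def)
     apply (simp add: ram_prog_def input_state_def)
    apply (rule reach_one)
      apply (simp add: ram_prog_def input_state_def)
     apply (simp add: ram_prog_def input_state_def)
    using W2 W2' by (simp add: ram_prog_def input_state_def numeral_2_eq_2)
  \<comment> \<open>The input already lies in array 0 and all memory past it is 0, so no cell has to
    be initialised.\<close>
  moreover have "represents S ?v init ?s2"
  proof -
    have "mem ?s2 (k * S + i) = init k i" for k i
      by (cases k) (auto simp: input_state_def init_def)
    then show ?thesis by (auto simp: represents_def input_state_def)
  qed
  moreover have "code_at ram_prog (pc ?s2) (compile prog (pc ?s2))"
    by (simp add: ram_prog_def code_at_def)
  ultimately obtain s' where s': "reach w (8 * S) ram_prog (2 + t) ?s s'"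
    "pc s' = 2 + clen prog" "represents S v' A' s'"
    using compile_correct[OF big _ _ S, of ram_prog ?s2] reach_trans by (force simp: numeral_2_eq_2)
  have "halted ram_prog s'" using s'(2) by (simp add: halted_def ram_prog_def)
  from reach_halts[OF s'(1) this] have h: "halts w ram_prog ?s" "run_time w ram_prog ?s \<le> 2 + t"
    "final_state w ram_prog ?s = s'" "run_space w ram_prog ?s \<le> 8 * S" by auto
  from Q obtain l where l: "l = h \<or> n \<le> s ^ l" "\<forall>i \<le> n - m. A' 0 i = mappability1 x m ! i"
    "t \<le> 1000 * n + 1000 + 640 * total_work x m l" unfolding Q_def by auto
  have "mem s' i = A' 0 i" if "i < S" for i
    using s'(3) that unfolding represents_def by (metis add_0 mult_0 zero_less_numeral)
  then have "solves_mappability1 w ram_prog x m"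
    using h l(2) by (auto simp: solves_mappability1_def)
  with h l show ?thesis by (intro exI[of _ l]) auto
qed

text \<open>The constant 10 is generous: \<open>n + 2 \<le> 2 * n\<close> reduces the claim to
  \<open>256 * n ^ 2 \<le> n ^ 10\<close>.\<close>

lemma word_size:
  assumes "5 \<le> n" "real w \<ge> 10 * log 2 (real n)"
  shows "64 * ((n + 2) * (n + 2)) \<le> (2::nat) ^ w"
proof -
  have "real n ^ 10 = (2 powr log 2 (real n)) powr 10"
    using assms by (simp add: powr_numeral)
  also have "\<dots> = 2 powr (10 * log 2 (real n))"
    by (simp only: powr_powr mult.commute)
  also have "\<dots> \<le> 2 powr real w" using assms by (intro powr_mono) auto
  also have "\<dots> = 2 ^ w" by (simp add: powr_realpow)
  finally have "n ^ 10 \<le> 2 ^ w" by (metis of_nat_le_iff of_nat_numeral of_nat_power)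
  moreover have "64 * ((n + 2) * (n + 2)) \<le> n ^ 10"
  proof -
    have "(n + 2) * (n + 2) \<le> (2 * n) * (2 * n)" using assms by (intro mult_le_mono) auto
    moreover have "(5::nat) ^ 8 \<le> n ^ 8" using assms by (intro power_mono) auto
    then have "256 * (n * n) \<le> n ^ 8 * (n * n)" by (intro mult_right_mono) auto
    moreover have "n ^ 8 * (n * n) = n ^ 10" by (simp add: eval_nat_numeral)
    ultimately show ?thesis by linarith
  qed
  ultimately show ?thesis by linarith
qed

theorem theorem1:
  "\<exists>(P :: program) (c :: real) (k :: real).
     \<forall>(n :: nat) (m :: nat) (\<Sigma> :: nat set) (w :: nat).
       \<Sigma> \<subseteq> {1..n} \<longrightarrow> card \<Sigma> > 1 \<longrightarrow>
       1 \<le> m \<longrightarrow> m < n \<longrightarrow>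
       real m \<ge> 3 * (ln (real n) / ln (real (card \<Sigma>))) + 3 \<longrightarrow>
       real w \<ge> k * log 2 (real n) \<longrightarrow>
         (\<forall>x. length x = n \<and> set x \<subseteq> \<Sigma> \<longrightarrow>
            solves_mappability1 w P x m \<and>
            real (run_space w P (input_state x m)) \<le> c * real n) \<and>
         measure_pmf.expectation (replicate_pmf n (pmf_of_set \<Sigma>))
           (\<lambda>x. real (run_time w P (input_state x m))) \<le> c * real n"
proof (intro exI allI impI)
  fix n m :: nat and \<Sigma> :: "nat set" and w :: nat
  assume \<Sigma>: "\<Sigma> \<subseteq> {1..n}" "card \<Sigma> > 1" and m: "1 \<le> m" "m < n"
    and large: "real m \<ge> 3 * (ln (real n) / ln (real (card \<Sigma>))) + 3"
    and w: "real w \<ge> 10 * log 2 (real n)"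
  let ?s = "card \<Sigma>"
  have fin: "finite \<Sigma>" using \<Sigma>(1) finite_subset by blast
  have ne: "\<Sigma> \<noteq> {}" using \<Sigma>(2) by auto
  have s2: "2 \<le> ?s" "2 \<le> n" using \<Sigma> m by auto
  note b = block_bounds[OF s2 large]
  have n5: "5 \<le> n" using b(1) m by simp
  have "3 * n \<le> n * m" using b(1) by simp
  with b(2) have nh: "n \<le> ?s ^ (m div 2)" by linarith
  define l0 where "l0 = (LEAST L. n \<le> ?s ^ L)"
  have l0: "n \<le> ?s ^ l0" unfolding l0_def by (rule LeastI[of _ "m div 2"]) (rule nh)
  have run: "solves_mappability1 w ram_prog x m \<and>
      run_space w ram_prog (input_state x m) \<le> 8 * (n + 2) \<and>
      run_time w ram_prog (input_state x m) \<le> 1002 + 1000 * n + 640 * total_work x m l0"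
    if x: "length x = n" "set x \<subseteq> \<Sigma>" for x
  proof -
    obtain l where l: "l = m div 2 \<or> n \<le> card (set x) ^ l" "solves_mappability1 w ram_prog x m"
      "run_space w ram_prog (input_state x m) \<le> 8 * (n + 2)"
      "run_time w ram_prog (input_state x m) \<le> 1002 + 1000 * n + 640 * total_work x m l"
      using ram_prog_correct[of x m w] x \<Sigma>(1) b(1) m(2) word_size[OF n5 w] by auto
    \<comment> \<open>Whichever test fixed \<open>l\<close>, \<open>n \<le> ?s ^ l\<close> follows:
      at most \<open>?s\<close> different letters occur, and for \<open>l = m div 2\<close> it is
      \<open>nh\<close>.\<close>
    have "card (set x) ^ l \<le> ?s ^ l" using x fin by (intro power_mono card_mono) auto
    with l(1) nh have "n \<le> ?s ^ l" by auto
    then have "l0 \<le> l" unfolding l0_def by (rule Least_le)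
    from total_work_mono[OF this, of x m] l show ?thesis by linarith
  qed
  have "(\<Sum>x\<in>strings n \<Sigma>. real (run_time w ram_prog (input_state x m))) \<le>
      (\<Sum>x\<in>strings n \<Sigma>. 1002 + 1000 * real n + 640 * real (total_work x m l0))"
  proof (rule sum_mono)
    fix x assume "x \<in> strings n \<Sigma>"
    then have "run_time w ram_prog (input_state x m) \<le> 1002 + 1000 * n + 640 * total_work x m l0"
      using run by (simp add: strings_def)
    then have "real (run_time w ram_prog (input_state x m)) \<le>
        real (1002 + 1000 * n + 640 * total_work x m l0)" by (simp only: of_nat_le_iff)
    then show "real (run_time w ram_prog (input_state x m)) \<le>
        1002 + 1000 * real n + 640 * real (total_work x m l0)" by simp
  qed
  also have "\<dots> = real ?s ^ n * (1002 + 1000 * real n) +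
      640 * (\<Sum>x\<in>strings n \<Sigma>. real (total_work x m l0))"
    using fin by (simp add: sum.distrib card_strings flip: sum_distrib_left)
  also have "\<dots> \<le> real ?s ^ n * (1002 + 1000 * real n) + 640 * (real ?s ^ n * (5 * real n))"
    by (intro add_left_mono mult_left_mono sum_total_work[OF fin s2(1) l0 b(2)]) simp
  \<comment> \<open>4200 is \<open>1000 + 640 * 5\<close>, the 5 coming from
    \<open>sum_total_work\<close>.\<close>
  also have "\<dots> = real ?s ^ n * (1002 + 4200 * real n)" by (simp add: algebra_simps)
  also have "\<dots> \<le> real ?s ^ n * (10000 * real n)" using n5 by (intro mult_left_mono) auto
  finally have "(\<Sum>x\<in>strings n \<Sigma>. real (run_time w ram_prog (input_state x m))) / real ?s ^ n \<le>
      10000 * real n"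
    using s2(1) by (simp add: divide_le_eq mult.commute)
  moreover have "solves_mappability1 w ram_prog x m \<and>
      real (run_space w ram_prog (input_state x m)) \<le> 10000 * real n"
    if "length x = n \<and> set x \<subseteq> \<Sigma>" for x
    using run[of x] that n5 by auto
  ultimately show "(\<forall>x. length x = n \<and> set x \<subseteq> \<Sigma> \<longrightarrow>
      solves_mappability1 w ram_prog x m \<and>
      real (run_space w ram_prog (input_state x m)) \<le> 10000 * real n) \<and>
    measure_pmf.expectation (replicate_pmf n (pmf_of_set \<Sigma>))
      (\<lambda>x. real (run_time w ram_prog (input_state x m))) \<le> 10000 * real n"
    by (simp add: expectation_replicate_pmf_of_set[OF fin ne])
qed

end
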